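(* Let $\xi\in\mathbb{C}$. For $k\in\mathbb{C}$ let $\mathcal{K}^{\xi,k}(x)$ be the linear operator on $M^k$ defined by $$\mathcal{K}^{\xi,k}(x)m_n^k=C_n^k(x;\xi)m_n^k\quad(n\ge1),\qquad C_n^k(x;\xi):=\prod_{j=1}^{n-1}\frac{\sinh(\xi-x+(k+\frac12-j)\eta)}{\sinh(\xi+x+(k+\frac12-j)\eta)},\quad C_1^k(x;\xi):=1.$$ Then these operators satisfy the reflection equation $$\mathcal{R}^{k\ell}(x-y)\mathcal{K}_{1}^{\xi,k}(x)\mathcal{R}^{k\ell}(x+y)\mathcal{K}_{2}^{\xi,\ell}(y)=\mathcal{K}_{2}^{\xi,\ell}(y)\mathcal{R}^{k\ell}(x+y)\mathcal{K}_{1}^{\xi,k}(x)\mathcal{R}^{k\ell}(x-y)$$ as operators on $M^k\otimes M^\ell$, for all $k,\ell\in\mathbb{C}$.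
   Context: Quantum affine $\mathfrak{sl}_2$. Fix $\eta\in\mathbb{C}$ generic, in particular such that $p:=e^\eta$ is not a root of unity; $p^x:=e^{\eta x}$. Let $\mathfrak{h}=\mathbb{C}h_0\oplus\mathbb{C}h_1$. $\widehat{\mathcal{U}}_\eta$ is the Hopf algebra generated by $e_i,f_i$ ($i=0,1$), $p^h$ ($h\in\mathfrak{h}$) with relations $p^0=1$, $p^{h+h'}=p^hp^{h'}$, $p^he_ip^{-h}=p^{\alpha_i(h)}e_i$, $p^hf_ip^{-h}=p^{-\alpha_i(h)}f_i$, $[e_i,f_j]=\delta_{i,j}\frac{p^{h_i}-p^{-h_i}}{p-p^{-1}}$ and, for $i\neq j$, $e_i^3e_j-(p^2+1+p^{-2})e_i^2e_je_i+(p^2+1+p^{-2})e_ie_je_i^2-e_je_i^3=0$ and the same with $f$'s; here $\alpha_j(h_i)=2$ if $i=j$ and $-2$ if $i\ne j$. Comultiplication: $\Delta(p^h)=p^h\otimes p^h$, $\Delta(e_i)=e_i\otimes1+p^{-h_i}\otimes e_i$, $\Delta(f_i)=f_i\otimes p^{h_i}+1\otimes f_i$; $\Delta^{\mathrm{op}}$ is the opposite comultiplication. $\mathcal{U}_\eta$ is the subalgebra generated by $e_1,f_1,p^{\lambda h_1}$ ($\lambda\in\mathbb{C}$). Verma modules. For $\ell\in\mathbb{C}$, $M^\ell=\bigoplus_{n\ge1}\mathbb{C}m_n^\ell$ is the $\mathcal{U}_\eta$-module with $\pi^\ell(p^{\lambda h_1})m_n^\ell=p^{2\lambda(\ell+1-n)}m_n^\ell$,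 $\pi^\ell(e_1)m_n^\ell=\frac{\sinh((n-1)\eta)\sinh((2\ell+2-n)\eta)}{\sinh(\eta)^2}m_{n-1}^\ell$, $\pi^\ell(f_1)m_n^\ell=m_{n+1}^\ell$ ($m_0^\ell:=0$). For $x\in\mathbb{C}$, $\phi_x:\widehat{\mathcal{U}}_\eta\to\mathcal{U}_\eta$ is the algebra homomorphism with $p^{\lambda h_0}\mapsto p^{-\lambda h_1}$, $p^{\lambda h_1}\mapsto p^{\lambda h_1}$, $e_0\mapsto e^{-x}f_1$, $e_1\mapsto e^{-x}e_1$, $f_0\mapsto e^xe_1$, $f_1\mapsto e^xf_1$; $\pi^\ell_x:=\pi^\ell\circ\phi_x$. $R$-operators. For $k,\ell\in\mathbb{C}$, $\mathcal{R}^{k\ell}(x)$ is the linear operator on $M^k\otimes M^\ell$, with matrix coefficients rational in $e^x$ (and in $p^k,p^\ell$), uniquely determined by $\mathcal{R}^{k\ell}(x)(m_1^k\otimes m_1^\ell)=m_1^k\otimes m_1^\ell$ and, for generic $x,y$, $\mathcal{R}^{k\ell}(x-y)(\pi^k_x\otimes\pi^\ell_y)(\Delta(X))=(\pi_x^k\otimes\pi_y^\ell)(\Delta^{\mathrm{op}}(X))\mathcal{R}^{k\ell}(x-y)$ for all $X\in\widehat{\mathcal{U}}_\eta$ (it is the normalized evaluation of the truncated universal $R$-matrix). Notation: $\mathcal{K}_1^{\xi,k}(x)=\mathcal{K}^{\xi,k}(x)\otimes\mathrm{Id}_{M^\ell}$, $\mathcal{K}_2^{\xi,\ell}(y)=\mathrm{Id}_{M^k}\otimes\mathcal{K}^{\xi,\ell}(y)$.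 The equation is an identity of operators depending meromorphically on $x,y\in\mathbb{C}$. *)

theory Defs
  imports
    "HOL-Analysis.Analysis"
    "HOL-Computational_Algebra.Polynomial"
    "HOL-Library.Poly_Mapping"
begin

section \<open>Complex vector spaces with a basis\<close>

text \<open>
  The complex vector space with basis indexed by a type \<open>'a\<close> is \<open>'a \<Rightarrow>\<^sub>0 complex\<close>; the tensor product
  of two such spaces is the one with basis indexed by pairs.
\<close>

definition scaleC :: "complex \<Rightarrow> ('a \<Rightarrow>\<^sub>0 complex) \<Rightarrow> ('a \<Rightarrow>\<^sub>0 complex)"
  where "scaleC c v = Poly_Mapping.map ((*) c) v"

lemma lookup_scaleC [simp]: "Poly_Mapping.lookup (scaleC c v) i = c * Poly_Mapping.lookup v i"
  by (auto simp: scaleC_def Poly_Mapping.map.rep_eq when_def)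

lemma vector_space_scaleC: "vector_space (scaleC :: complex \<Rightarrow> ('a \<Rightarrow>\<^sub>0 complex) \<Rightarrow> _)"
  by unfold_locales (auto intro!: poly_mapping_eqI simp: lookup_add algebra_simps)

abbreviation linear_op :: "(('a \<Rightarrow>\<^sub>0 complex) \<Rightarrow> ('b \<Rightarrow>\<^sub>0 complex)) \<Rightarrow> bool"
  where "linear_op \<equiv> Vector_Spaces.linear scaleC scaleC"

abbreviation basis_vec :: "'a \<Rightarrow> ('a \<Rightarrow>\<^sub>0 complex)"
  where "basis_vec i \<equiv> Poly_Mapping.single i 1"

definition lin_ext :: "('a \<Rightarrow> ('b \<Rightarrow>\<^sub>0 complex)) \<Rightarrow> ('a \<Rightarrow>\<^sub>0 complex) \<Rightarrow> ('b \<Rightarrow>\<^sub>0 complex)"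
  where "lin_ext b v = (\<Sum>i\<in>Poly_Mapping.keys v. scaleC (Poly_Mapping.lookup v i) (b i))"

definition tensor :: "('a \<Rightarrow>\<^sub>0 complex) \<Rightarrow> ('b \<Rightarrow>\<^sub>0 complex) \<Rightarrow> ('a \<times> 'b \<Rightarrow>\<^sub>0 complex)"  (infixr \<open>\<otimes>\<^sub>v\<close> 75)
  where "u \<otimes>\<^sub>v v =
    (\<Sum>i\<in>Poly_Mapping.keys u. \<Sum>j\<in>Poly_Mapping.keys v.
       Poly_Mapping.single (i, j) (Poly_Mapping.lookup u i * Poly_Mapping.lookup v j))"

definition tensor_map ::
    "(('a \<Rightarrow>\<^sub>0 complex) \<Rightarrow> ('c \<Rightarrow>\<^sub>0 complex)) \<Rightarrow> (('b \<Rightarrow>\<^sub>0 complex) \<Rightarrow> ('d \<Rightarrow>\<^sub>0 complex)) \<Rightarrow>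
     ('a \<times> 'b \<Rightarrow>\<^sub>0 complex) \<Rightarrow> ('c \<times> 'd \<Rightarrow>\<^sub>0 complex)"
  where "tensor_map f g = lin_ext (\<lambda>(i, j). f (basis_vec i) \<otimes>\<^sub>v g (basis_vec j))"

definition flip :: "('a \<times> 'b \<Rightarrow>\<^sub>0 complex) \<Rightarrow> ('b \<times> 'a \<Rightarrow>\<^sub>0 complex)"
  where "flip = lin_ext (\<lambda>(i, j). basis_vec (j, i))"

definition mat_coeff :: "(('a \<Rightarrow>\<^sub>0 complex) \<Rightarrow> ('b \<Rightarrow>\<^sub>0 complex)) \<Rightarrow> 'b \<Rightarrow> 'a \<Rightarrow> complex"
  where "mat_coeff f i j = Poly_Mapping.lookup (f (basis_vec j)) i"

text \<open>
  A family of operators is regular at \<open>x\<close> if none of its matrix coefficients has a pole there.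
  Requiring analyticity also excludes the points where a total HOL function takes a conventional
  value (such as \<open>1 / 0 = 0\<close>) differing from that of the meromorphic function it represents.
\<close>
definition regular_at ::
    "(complex \<Rightarrow> ('a \<Rightarrow>\<^sub>0 complex) \<Rightarrow> ('b \<Rightarrow>\<^sub>0 complex)) \<Rightarrow> complex \<Rightarrow> bool"
  where "regular_at T x \<longleftrightarrow> (\<forall>i j. (\<lambda>z. mat_coeff (T z) i j) analytic_on {x})"


section \<open>Free associative algebras\<close>

text \<open>
  The free associative unital algebra on \<open>'g\<close> is the algebra of the free monoid on \<open>'g\<close>, with the
  convolution product of \<^theory>\<open>HOL-Library.Poly_Mapping\<close>. Its tensor square is the algebra of
  the product monoid.
\<close>

datatype 'g monomial = Mono (letters: "'g list")

instantiation monomial :: (type) monoid_add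
begin
definition zero_monomial :: "'a monomial" where "0 = Mono []"
definition plus_monomial :: "'a monomial \<Rightarrow> 'a monomial \<Rightarrow> 'a monomial"
  where "u + v = Mono (letters u @ letters v)"
instance by standard (auto simp: zero_monomial_def plus_monomial_def)
end

type_synonym 'g free_alg = "'g monomial \<Rightarrow>\<^sub>0 complex"

definition gen :: "'g \<Rightarrow> 'g free_alg"
  where "gen g = basis_vec (Mono [g])"

definition alg_hom_ext :: "('g \<Rightarrow> ('k::monoid_add \<Rightarrow>\<^sub>0 complex)) \<Rightarrow> 'g free_alg \<Rightarrow> ('k \<Rightarrow>\<^sub>0 complex)"
  where "alg_hom_ext \<phi> = lin_ext (\<lambda>w. prod_list (map \<phi> (letters w)))"

definition rep_ext ::
    "('g \<Rightarrow> ('v \<Rightarrow>\<^sub>0 complex) \<Rightarrow> ('v \<Rightarrow>\<^sub>0 complex)) \<Rightarrow>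
     'g free_alg \<Rightarrow> ('v \<Rightarrow>\<^sub>0 complex) \<Rightarrow> ('v \<Rightarrow>\<^sub>0 complex)"
  where "rep_ext \<rho> X v = lin_ext (\<lambda>w. foldr \<rho> (letters w) v) X"

definition rep_tensor ::
    "('g free_alg \<Rightarrow> ('v \<Rightarrow>\<^sub>0 complex) \<Rightarrow> ('v \<Rightarrow>\<^sub>0 complex)) \<Rightarrow>
     ('g free_alg \<Rightarrow> ('w \<Rightarrow>\<^sub>0 complex) \<Rightarrow> ('w \<Rightarrow>\<^sub>0 complex)) \<Rightarrow>
     ('g monomial \<times> 'g monomial \<Rightarrow>\<^sub>0 complex) \<Rightarrow> ('v \<times> 'w \<Rightarrow>\<^sub>0 complex) \<Rightarrow> ('v \<times> 'w \<Rightarrow>\<^sub>0 complex)"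
  where "rep_tensor \<rho> \<sigma> T v =
    lin_ext (\<lambda>(u, w). tensor_map (\<rho> (basis_vec u)) (\<sigma> (basis_vec w)) v) T"


section \<open>Quantum affine sl2\<close>

definition p_pow :: "complex \<Rightarrow> complex \<Rightarrow> complex"
  where "p_pow \<eta> x = exp (\<eta> * x)"

datatype node = N0 | N1

text \<open>The pair \<open>(a, b)\<close> stands for the element \<open>a h\<^sub>0 + b h\<^sub>1\<close> of the Cartan subalgebra.\<close>
type_synonym cartan = "complex \<times> complex"

fun coroot :: "node \<Rightarrow> cartan" where
  "coroot N0 = (1, 0)"
| "coroot N1 = (0, 1)"

fun simple_root :: "node \<Rightarrow> cartan \<Rightarrow> complex" where
  "simple_root N0 (a, b) = 2 * a - 2 * b"
| "simple_root N1 (a, b) = 2 * b - 2 * a"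

text \<open>\<open>GP h\<close> stands for the generator \<open>p\<^sup>h\<close>.\<close>
datatype aff_gen = GE node | GF node | GP cartan

definition serre :: "complex \<Rightarrow> aff_gen free_alg \<Rightarrow> aff_gen free_alg \<Rightarrow> aff_gen free_alg"
  where "serre \<eta> a b =
    (let c = p_pow \<eta> 2 + 1 + p_pow \<eta> (-2)
     in a * a * a * b - scaleC c (a * a * b * a) + scaleC c (a * b * a * a) - b * a * a * a)"

inductive_set aff_relators :: "complex \<Rightarrow> aff_gen free_alg set" for \<eta> :: complex where
  P_zero: "gen (GP 0) - 1 \<in> aff_relators \<eta>"
| P_add: "gen (GP (h + h')) - gen (GP h) * gen (GP h') \<in> aff_relators \<eta>"
| P_E: "gen (GP h) * gen (GE i) * gen (GP (- h)) - scaleC (p_pow \<eta> (simple_root i h)) (gen (GE i))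
    \<in> aff_relators \<eta>"
| P_F: "gen (GP h) * gen (GF i) * gen (GP (- h)) - scaleC (p_pow \<eta> (- simple_root i h)) (gen (GF i))
    \<in> aff_relators \<eta>"
| E_F: "gen (GE i) * gen (GF j) - gen (GF j) * gen (GE i)
      - (if i = j
         then scaleC (1 / (p_pow \<eta> 1 - p_pow \<eta> (-1))) (gen (GP (coroot i)) - gen (GP (- coroot i)))
         else 0)
    \<in> aff_relators \<eta>"
| serre_E: "i \<noteq> j \<Longrightarrow> serre \<eta> (gen (GE i)) (gen (GE j)) \<in> aff_relators \<eta>"
| serre_F: "i \<noteq> j \<Longrightarrow> serre \<eta> (gen (GF i)) (gen (GF j)) \<in> aff_relators \<eta>"

text \<open>The two-sided ideal generated by the relators; it is closed under scalars, as \<open>a\<close> is arbitrary.\<close>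
inductive_set aff_ideal :: "complex \<Rightarrow> aff_gen free_alg set" for \<eta> :: complex where
  zero: "0 \<in> aff_ideal \<eta>"
| add: "X \<in> aff_ideal \<eta> \<Longrightarrow> r \<in> aff_relators \<eta> \<Longrightarrow> X + a * r * b \<in> aff_ideal \<eta>"

definition quantum_affine_sl2 :: "complex \<Rightarrow> aff_gen free_alg set set"
  where "quantum_affine_sl2 \<eta> = UNIV // {(X, Y). X - Y \<in> aff_ideal \<eta>}"

text \<open>
  Maps out of the quotient are given by their values on representatives in the free algebra; the
  comultiplication and the evaluation representations below respect the relations.
\<close>

fun comult_gen :: "aff_gen \<Rightarrow> (aff_gen monomial \<times> aff_gen monomial \<Rightarrow>\<^sub>0 complex)" where
  "comult_gen (GP h) = gen (GP h) \<otimes>\<^sub>v gen (GP h)"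
| "comult_gen (GE i) = gen (GE i) \<otimes>\<^sub>v 1 + gen (GP (- coroot i)) \<otimes>\<^sub>v gen (GE i)"
| "comult_gen (GF i) = gen (GF i) \<otimes>\<^sub>v gen (GP (coroot i)) + 1 \<otimes>\<^sub>v gen (GF i)"

definition comult :: "aff_gen free_alg \<Rightarrow> (aff_gen monomial \<times> aff_gen monomial \<Rightarrow>\<^sub>0 complex)"
  where "comult = alg_hom_ext comult_gen"

definition comult_op :: "aff_gen free_alg \<Rightarrow> (aff_gen monomial \<times> aff_gen monomial \<Rightarrow>\<^sub>0 complex)"
  where "comult_op X = flip (comult X)"


section \<open>Verma modules and evaluation representations\<close>

text \<open>
  Generators \<open>e\<^sub>1\<close>, \<open>f\<^sub>1\<close>, \<open>p\<^bsup>\<lambda> h\<^sub>1\<^esup>\<close> of the subalgebra of the quantum affine algebra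
  isomorphic to quantum sl2.
\<close>
datatype fin_gen = ge1 | gf1 | gp_h1 complex

text \<open>
  Every Verma module has underlying space \<open>nat \<Rightarrow>\<^sub>0 complex\<close>. The basis vectors are numbered from 1 on,
  so that \<open>mvec n\<close> sits at index \<open>n - 1\<close>; there \<open>mvec 0 = 0\<close>.
\<close>
type_synonym verma = "nat \<Rightarrow>\<^sub>0 complex"
type_synonym verma2 = "nat \<times> nat \<Rightarrow>\<^sub>0 complex"

definition mvec :: "nat \<Rightarrow> verma"
  where "mvec n = (if n = 0 then 0 else basis_vec (n - 1))"

definition verma_op :: "(nat \<Rightarrow> verma) \<Rightarrow> verma \<Rightarrow> verma"
  where "verma_op b = lin_ext (\<lambda>i. b (Suc i))"

fun verma_gen :: "complex \<Rightarrow> complex \<Rightarrow> fin_gen \<Rightarrow> verma \<Rightarrow> verma" where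
  "verma_gen \<eta> l (gp_h1 c) = verma_op (\<lambda>n. scaleC (p_pow \<eta> (2 * c * (l + 1 - of_nat n))) (mvec n))"
| "verma_gen \<eta> l ge1 = verma_op (\<lambda>n. scaleC
     (sinh ((of_nat n - 1) * \<eta>) * sinh ((2 * l + 2 - of_nat n) * \<eta>) / (sinh \<eta>)\<^sup>2) (mvec (n - 1)))"
| "verma_gen \<eta> l gf1 = verma_op (\<lambda>n. mvec (n + 1))"

fun phi_gen :: "complex \<Rightarrow> aff_gen \<Rightarrow> fin_gen free_alg" where
  "phi_gen x (GP (a, b)) = gen (gp_h1 (b - a))"
| "phi_gen x (GE N0) = scaleC (exp (- x)) (gen gf1)"
| "phi_gen x (GE N1) = scaleC (exp (- x)) (gen ge1)"
| "phi_gen x (GF N0) = scaleC (exp x) (gen ge1)"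
| "phi_gen x (GF N1) = scaleC (exp x) (gen gf1)"

definition eval_rep :: "complex \<Rightarrow> complex \<Rightarrow> complex \<Rightarrow> aff_gen free_alg \<Rightarrow> verma \<Rightarrow> verma"
  where "eval_rep \<eta> l x X = rep_ext (verma_gen \<eta> l) (alg_hom_ext (phi_gen x) X)"


section \<open>R-operators\<close>

definition intertwines ::
    "complex \<Rightarrow> complex \<Rightarrow> complex \<Rightarrow> complex \<Rightarrow> complex \<Rightarrow> (verma2 \<Rightarrow> verma2) \<Rightarrow> bool"
  where "intertwines \<eta> k l x y T \<longleftrightarrow>
    (\<forall>C\<in>quantum_affine_sl2 \<eta>. \<forall>X\<in>C.
       T \<circ> rep_tensor (eval_rep \<eta> k x) (eval_rep \<eta> l y) (comult X)
       = rep_tensor (eval_rep \<eta> k x) (eval_rep \<eta> l y) (comult_op X) \<circ> T)"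

text \<open>
  A polynomial in \<open>p\<^sup>k\<close>, \<open>p\<^sup>l\<close> and \<open>e\<^sup>x\<close> is represented with \<open>p\<^sup>k\<close> as outermost and \<open>e\<^sup>x\<close> as innermost
  variable. This is its specialization to given \<open>k\<close>, \<open>l\<close>, a polynomial in \<open>e\<^sup>x\<close>.
\<close>
definition specialize ::
    "complex \<Rightarrow> complex \<Rightarrow> complex \<Rightarrow> complex poly poly poly \<Rightarrow> complex poly"
  where "specialize \<eta> k l Q = poly (poly Q [:[:p_pow \<eta> k:]:]) [:p_pow \<eta> l:]"

definition rational_coeff :: "complex \<Rightarrow> (complex \<Rightarrow> complex \<Rightarrow> complex \<Rightarrow> complex) \<Rightarrow> bool"
  where "rational_coeff \<eta> c \<longleftrightarrow>
    (\<exists>P Q. \<forall>k l. specialize \<eta> k l Q \<noteq> 0 \<and>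
       (\<forall>x. poly (specialize \<eta> k l Q) (exp x) \<noteq> 0 \<longrightarrow>
          c k l x = poly (specialize \<eta> k l P) (exp x) / poly (specialize \<eta> k l Q) (exp x)))"

text \<open>
  The characterization of the family \<open>R k l x\<close>. Its value at a pole of some matrix coefficient
  carries no information. Generic \<open>x\<close>, \<open>y\<close> are those with \<open>x - y\<close> outside a countable set (which may
  depend on \<open>k\<close>, \<open>l\<close>): there are infinitely many matrix coefficients, and each has countably many
  poles.
\<close>
definition is_R_operator ::
    "complex \<Rightarrow> (complex \<Rightarrow> complex \<Rightarrow> complex \<Rightarrow> verma2 \<Rightarrow> verma2) \<Rightarrow> bool"
  where "is_R_operator \<eta> R \<longleftrightarrow>
    (\<forall>k l x. linear_op (R k l x)) \<and>
    (\<forall>i j. rational_coeff \<eta> (\<lambda>k l x. mat_coeff (R k l x) i j)) \<and>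
    (\<forall>k l x. R k l x (mvec 1 \<otimes>\<^sub>v mvec 1) = mvec 1 \<otimes>\<^sub>v mvec 1) \<and>
    (\<forall>k l. \<exists>Z. countable Z \<and> (\<forall>x y. x - y \<notin> Z \<longrightarrow> intertwines \<eta> k l x y (R k l (x - y))))"


section \<open>K-operators\<close>

definition K_coeff :: "complex \<Rightarrow> complex \<Rightarrow> complex \<Rightarrow> nat \<Rightarrow> complex \<Rightarrow> complex"
  where "K_coeff \<eta> \<xi> k n x =
    (\<Prod>j = 1..n - 1. sinh (\<xi> - x + (k + 1 / 2 - of_nat j) * \<eta>)
                   / sinh (\<xi> + x + (k + 1 / 2 - of_nat j) * \<eta>))"

definition K_op :: "complex \<Rightarrow> complex \<Rightarrow> complex \<Rightarrow> complex \<Rightarrow> verma \<Rightarrow> verma"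
  where "K_op \<eta> \<xi> k x = verma_op (\<lambda>n. scaleC (K_coeff \<eta> \<xi> k n x) (mvec n))"

definition K1_op :: "complex \<Rightarrow> complex \<Rightarrow> complex \<Rightarrow> complex \<Rightarrow> verma2 \<Rightarrow> verma2"
  where "K1_op \<eta> \<xi> k x = tensor_map (K_op \<eta> \<xi> k x) id"

definition K2_op :: "complex \<Rightarrow> complex \<Rightarrow> complex \<Rightarrow> complex \<Rightarrow> verma2 \<Rightarrow> verma2"
  where "K2_op \<eta> \<xi> l y = tensor_map id (K_op \<eta> \<xi> l y)"

end

theory Submission
  imports Defs
begin

text \<open>
  The diagonal K-operators belong to a coideal subalgebra \<open>B\<close> of quantum affine sl2, generated by
  Cartan elements, a lowering element \<open>\<alpha> f\<^sub>1 - \<alpha>\<^sup>-\<^sup>1 e\<^sub>0 p\<^bsup>h\<^sub>0\<^esup>\<close> with \<open>\<alpha> = exp (\<xi> - \<eta> / 2)\<close>, and a raising element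
  \<open>\<gamma> e\<^sub>1 p\<^bsup>h\<^sub>1\<^esup> - \<gamma>\<^sup>-\<^sup>1 f\<^sub>0\<close> with \<open>\<gamma> = exp (\<xi> + \<eta> / 2)\<close>. In the evaluation module at \<open>x\<close> each of the two acts
  by a shift of the basis, with a hyperbolic sine as the part of the coefficient that depends on \<open>x\<close>,
  and the product formula for the K-operator says exactly that it intertwines the action at \<open>x\<close> with
  the action at \<open>-x\<close> (\<open>K_coeff_Suc\<close>, \<open>K_coeff_up\<close>). The comultiplication of these elements lies in
  \<open>U \<otimes> B\<close>, with \<open>U\<close> the whole algebra, so the K-operator of the second factor still intertwines them on
  a tensor product, and that of the first factor does so for the opposite comultiplication.

  The R-operator at \<open>x - y\<close> intertwines the comultiplication with its opposite at \<open>(x, y)\<close>.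
  Since \<open>e\<^sub>0\<close> and \<open>f\<^sub>1\<close> evaluate to multiples of the same operator, with opposite powers of \<open>e\<^sup>x\<close>, and so
  do \<open>e\<^sub>1\<close> and \<open>f\<^sub>0\<close>, the same relations say that it intertwines the opposite comultiplication with the
  comultiplication at \<open>(-x, -y)\<close> (\<open>intertwines_coideal\<close>). Both sides of the reflection equation therefore
  intertwine the action of \<open>B\<close> at \<open>(x, y)\<close> with the one at \<open>(-x, -y)\<close>, and both fix the vacuum
  (\<open>reflection_sides_coideal\<close>).

  Hence they agree wherever the vacuum generates \<open>M\<^sup>k \<otimes> M\<^sup>l\<close> under \<open>B\<close>. At generic parameters the image of the lowering
  operator has codimension one in each weight space, and one further vector, \<open>Y X\<^sup>2 w\<close> for the lowering and
  raising operators \<open>X\<close>, \<open>Y\<close> and a basis vector \<open>w\<close>, fills the gap provided that a single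
  determinant per weight does not vanish (\<open>vacuum_cyclic\<close>). Divided by \<open>exp (4 * x)\<close>, that determinant is a
  polynomial in \<open>exp (- 2 * x)\<close> whose constant term is nonzero for all but countably many \<open>y\<close>, whatever
  \<open>k\<close>, \<open>l\<close> and \<open>\<xi>\<close> are; this is where \<open>p\<close> not being a root of unity enters (\<open>e_coeff_step\<close>,
  \<open>countable_cyclic_det_zeros\<close>). So for fixed \<open>k\<close>, \<open>l\<close>, \<open>\<xi>\<close> the equation holds for \<open>(x, y)\<close> in a dense
  set (\<open>reflection_generic\<close>).

  All operators preserve the weight, so each matrix coefficient of either side is a finite sum of
  products of matrix coefficients of the factors. These are continuous at a regular point, and the equation extends
  to every such point.
\<close>

section \<open>Linear operators on spaces with a basis\<close>

lemma linear_opI: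
  assumes "\<And>u v. f (u + v) = f u + f v" "\<And>c v. f (scaleC c v) = scaleC c (f v)"
  shows "linear_op f"
  unfolding Vector_Spaces.linear_iff by (intro conjI vector_space_scaleC allI assms)

lemma linear_op_add: "linear_op f \<Longrightarrow> f (u + v) = f u + f v"
  and linear_op_scale: "linear_op f \<Longrightarrow> f (scaleC c v) = scaleC c (f v)"
  by (auto simp: Vector_Spaces.linear_iff)

lemma linear_op_zero: "linear_op f \<Longrightarrow> f 0 = 0"
  using linear_op_add[of f 0 0] by simp

lemma linear_op_minus: "linear_op f \<Longrightarrow> f (u - v) = f u - f v"
  using linear_op_add[of f "u - v" v] by (simp add: algebra_simps)

lemma linear_op_sum: "linear_op f \<Longrightarrow> f (\<Sum>i\<in>A. g i) = (\<Sum>i\<in>A. f (g i))"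
  by (induction A rule: infinite_finite_induct) (auto simp: linear_op_zero linear_op_add)

lemma linear_op_compose: "linear_op f \<Longrightarrow> linear_op g \<Longrightarrow> linear_op (f \<circ> g)"
  by (rule linear_opI) (auto simp: linear_op_add linear_op_scale)

lemma scaleC_add: "scaleC c (u + v) = scaleC c u + scaleC c v"
  and scaleC_left_add: "scaleC (c + d) u = scaleC c u + scaleC d u"
  and scaleC_scaleC [simp]: "scaleC c (scaleC d u) = scaleC (c * d) u"
  and scaleC_zero [simp]: "scaleC 0 u = 0" "scaleC c 0 = 0"
  and scaleC_one [simp]: "scaleC 1 u = u"
  and scaleC_diff: "scaleC c (u - v) = scaleC c u - scaleC c v"
  and scaleC_minus: "scaleC (- c) u = - scaleC c u"
  by (auto intro!: poly_mapping_eqI simp: lookup_add lookup_minus algebra_simps)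

lemma scaleC_single [simp]: "scaleC c (Poly_Mapping.single i a) = Poly_Mapping.single i (c * a)"
  by (rule poly_mapping_eqI) (auto simp: lookup_single when_def)

lemma linear_op_diff: "linear_op f \<Longrightarrow> linear_op g \<Longrightarrow> linear_op (\<lambda>v. f v - g v)"
  by (rule linear_opI) (auto simp: linear_op_add linear_op_scale scaleC_diff)

lemma linear_op_comb:
  "linear_op f \<Longrightarrow> linear_op g \<Longrightarrow> linear_op (\<lambda>v. scaleC a (f v) + scaleC b (g v))"
  by (rule linear_opI) (auto simp: linear_op_add linear_op_scale scaleC_add mult.commute)

lemma lin_ext_superset:
  assumes "finite A" "Poly_Mapping.keys v \<subseteq> A"
  shows "lin_ext b v = (\<Sum>i\<in>A. scaleC (Poly_Mapping.lookup v i) (b i))"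
  unfolding lin_ext_def
  by (rule sum.mono_neutral_left) (use assms in \<open>auto simp: in_keys_iff\<close>)

lemma linear_op_lin_ext [simp]: "linear_op (lin_ext b)"
proof (rule linear_opI)
  fix u v :: "'a \<Rightarrow>\<^sub>0 complex" and c
  let ?A = "Poly_Mapping.keys u \<union> Poly_Mapping.keys v"
  have *: "Poly_Mapping.keys (u + v) \<subseteq> ?A" by (rule Poly_Mapping.keys_add)
  show "lin_ext b (u + v) = lin_ext b u + lin_ext b v"
    using lin_ext_superset[of ?A "u + v" b] lin_ext_superset[of ?A u b]
      lin_ext_superset[of ?A v b] *
    by (simp add: lookup_add scaleC_left_add sum.distrib)
  have "Poly_Mapping.keys (scaleC c v) \<subseteq> Poly_Mapping.keys v"
    by (auto simp: in_keys_iff)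
  then have "lin_ext b (scaleC c v)
      = (\<Sum>i\<in>Poly_Mapping.keys v. scaleC c (scaleC (Poly_Mapping.lookup v i) (b i)))"
    by (subst lin_ext_superset[of "Poly_Mapping.keys v"]) auto
  also have "\<dots> = scaleC c (lin_ext b v)"
    unfolding lin_ext_def
    by (rule linear_op_sum[symmetric], rule linear_opI) (auto simp: scaleC_add mult.commute)
  finally show "lin_ext b (scaleC c v) = scaleC c (lin_ext b v)" .
qed

lemmas lin_ext_add = linear_op_add[OF linear_op_lin_ext]

lemma lin_ext_single [simp]: "lin_ext b (Poly_Mapping.single i c) = scaleC c (b i)"
  by (subst lin_ext_superset[of "{i}"]) auto

lemma lin_ext_one [simp]: "lin_ext b 1 = b 0"
  using lin_ext_single[of b 0 1] by (simp del: lin_ext_single)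

lemma linear_op_expand:
  assumes "linear_op f" "finite A" "Poly_Mapping.keys v \<subseteq> A"
  shows "f v = (\<Sum>i\<in>A. scaleC (Poly_Mapping.lookup v i) (f (basis_vec i)))"
proof -
  have "v = lin_ext basis_vec v"
    unfolding lin_ext_def
    by (rule poly_mapping_eqI) (simp add: lookup_sum lookup_single when_def in_keys_iff)
  also have "\<dots> = (\<Sum>i\<in>A. scaleC (Poly_Mapping.lookup v i) (basis_vec i))"
    by (rule lin_ext_superset[OF assms(2,3)])
  finally have "f v = f (\<Sum>i\<in>A. scaleC (Poly_Mapping.lookup v i) (basis_vec i))"
    by simp
  then show ?thesis
    by (simp only: linear_op_sum[OF assms(1)] linear_op_scale[OF assms(1)])
qed

lemma linear_op_eqI:
  assumes "linear_op f" "linear_op g" "\<And>i. f (basis_vec i) = g (basis_vec i)"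
  shows "f = g"
proof
  fix v
  show "f v = g v"
    using linear_op_expand[OF assms(1), of "Poly_Mapping.keys v" v]
      linear_op_expand[OF assms(2), of "Poly_Mapping.keys v" v] assms(3) by simp
qed

lemma linear_op_lookup_expand:
  assumes "linear_op f" "finite A" "Poly_Mapping.keys v \<subseteq> A"
  shows "Poly_Mapping.lookup (f v) r = (\<Sum>i\<in>A. Poly_Mapping.lookup v i * mat_coeff f r i)"
  by (subst linear_op_expand[OF assms]) (simp add: lookup_sum mat_coeff_def)

lemma tensor_single [simp]:
  "Poly_Mapping.single i a \<otimes>\<^sub>v Poly_Mapping.single j b = Poly_Mapping.single (i, j) (a * b)"
  by (cases "a = 0"; cases "b = 0") (auto simp: tensor_def)

lemma linear_op_tensor_map [simp]: "linear_op (tensor_map f g)"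
  by (simp add: tensor_map_def)

lemma tensor_map_single [simp]:
  "tensor_map f g (Poly_Mapping.single (i, j) c) = scaleC c (f (basis_vec i) \<otimes>\<^sub>v g (basis_vec j))"
  by (simp add: tensor_map_def)

section \<open>Weighted shifts on the tensor product\<close>

text \<open>
  Every operator below is built from weighted shifts of one of the two indices and diagonal operators.
  In \<open>raising\<close> the value of \<open>i - 1\<close> at \<open>i = 0\<close> is harmless because the coefficients of the
  raising generators vanish there.
\<close>
definition lowering ::
    "(nat \<Rightarrow> nat \<Rightarrow> complex) \<Rightarrow> (nat \<Rightarrow> nat \<Rightarrow> complex) \<Rightarrow> verma2 \<Rightarrow> verma2"
  where "lowering a b = lin_ext (\<lambda>(i, j).
    Poly_Mapping.single (Suc i, j) (a i j) + Poly_Mapping.single (i, Suc j) (b i j))"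

definition raising ::
    "(nat \<Rightarrow> nat \<Rightarrow> complex) \<Rightarrow> (nat \<Rightarrow> nat \<Rightarrow> complex) \<Rightarrow> verma2 \<Rightarrow> verma2"
  where "raising c d = lin_ext (\<lambda>(i, j).
    Poly_Mapping.single (i - 1, j) (c i j) + Poly_Mapping.single (i, j - 1) (d i j))"

definition diagonal :: "(nat \<Rightarrow> nat \<Rightarrow> complex) \<Rightarrow> verma2 \<Rightarrow> verma2"
  where "diagonal t = lin_ext (\<lambda>(i, j). Poly_Mapping.single (i, j) (t i j))"

lemma linear_op_ladder [simp]:
  "linear_op (lowering a b)" "linear_op (raising a b)" "linear_op (diagonal t)"
  by (simp_all add: lowering_def raising_def diagonal_def)

lemma ladder_single [simp]:
  "lowering a b (Poly_Mapping.single (i, j) s)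
     = Poly_Mapping.single (Suc i, j) (s * a i j) + Poly_Mapping.single (i, Suc j) (s * b i j)"
  "raising c d (Poly_Mapping.single (i, j) s)
     = Poly_Mapping.single (i - 1, j) (s * c i j) + Poly_Mapping.single (i, j - 1) (s * d i j)"
  "diagonal t (Poly_Mapping.single (i, j) s) = Poly_Mapping.single (i, j) (s * t i j)"
  by (simp_all add: lowering_def raising_def diagonal_def scaleC_add)

lemma lookup_diagonal:
  "Poly_Mapping.lookup (diagonal t v) (i, j) = t i j * Poly_Mapping.lookup v (i, j)"
proof -
  have "Poly_Mapping.lookup (diagonal t v) (i, j)
      = (\<Sum>q\<in>insert (i, j) (Poly_Mapping.keys v).
           Poly_Mapping.lookup v q * mat_coeff (diagonal t) (i, j) q)"
    by (rule linear_op_lookup_expand) auto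
  also have "\<dots> = (\<Sum>q\<in>{(i, j)}. Poly_Mapping.lookup v q * mat_coeff (diagonal t) (i, j) q)"
    by (rule sum.mono_neutral_right) (auto simp: mat_coeff_def lookup_single)
  finally show ?thesis by (simp add: mat_coeff_def)
qed

section \<open>Action of the generators on tensor products of evaluation modules\<close>

lemma alg_hom_ext_gen: "alg_hom_ext \<phi> (gen g) = \<phi> g"
  by (simp add: alg_hom_ext_def gen_def)

lemma alg_hom_ext_letter: "alg_hom_ext \<phi> (basis_vec (Mono [g])) = \<phi> g"
  using alg_hom_ext_gen[of \<phi> g] by (simp add: gen_def)

lemma rep_ext_letter: "rep_ext \<rho> (Poly_Mapping.single (Mono [g]) c) v = scaleC c (\<rho> g v)"
  by (simp add: rep_ext_def)

lemma eval_rep_gen: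
  "eval_rep \<eta> l x (basis_vec (Mono [g])) = rep_ext (verma_gen \<eta> l) (phi_gen x g)"
  by (simp add: eval_rep_def alg_hom_ext_gen flip: gen_def)

lemma eval_rep_one: "eval_rep \<eta> l x (basis_vec 0) v = v"
  by (simp add: eval_rep_def alg_hom_ext_def rep_ext_def zero_monomial_def)

lemma rep_tensor_add: "rep_tensor \<rho> \<sigma> (S + T) v = rep_tensor \<rho> \<sigma> S v + rep_tensor \<rho> \<sigma> T v"
  by (simp add: rep_tensor_def lin_ext_add)

lemma rep_tensor_basis:
  "rep_tensor \<rho> \<sigma> (basis_vec (u, w)) v = tensor_map (\<rho> (basis_vec u)) (\<sigma> (basis_vec w)) v"
  by (simp add: rep_tensor_def)

lemma flip_add: "flip (S + T) = flip S + flip T"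
  by (simp add: flip_def lin_ext_add)

lemma flip_basis: "flip (basis_vec (u, w)) = basis_vec (w, u)"
  by (simp add: flip_def)

text \<open>Here \<open>i\<close> counts from 0, so it stands for \<open>n - 1\<close> in the formulas for \<open>e\<^sub>1 m\<^sub>n\<close> and \<open>p\<^bsup>c h\<^sub>1\<^esup> m\<^sub>n\<close>.\<close>
definition e_coeff :: "complex \<Rightarrow> complex \<Rightarrow> nat \<Rightarrow> complex"
  where "e_coeff \<eta> k i = sinh (of_nat i * \<eta>) * sinh ((2 * k + 1 - of_nat i) * \<eta>) / (sinh \<eta>)\<^sup>2"

definition cartan_coeff :: "complex \<Rightarrow> complex \<Rightarrow> complex \<Rightarrow> nat \<Rightarrow> complex"
  where "cartan_coeff \<eta> c k i = exp (2 * c * \<eta> * (k - of_nat i))"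

lemma e_coeff_0 [simp]: "e_coeff \<eta> k 0 = 0"
  by (simp add: e_coeff_def)

declare verma_gen.simps [simp del]

lemma verma_gen_basis:
  "verma_gen \<eta> l gf1 (basis_vec i) = basis_vec (Suc i)"
  "verma_gen \<eta> l ge1 (basis_vec i) = Poly_Mapping.single (i - 1) (e_coeff \<eta> l i)"
  "verma_gen \<eta> l (gp_h1 c) (basis_vec i) = Poly_Mapping.single i (cartan_coeff \<eta> c l i)"
  by (cases i; simp add: verma_gen.simps verma_op_def mvec_def e_coeff_def cartan_coeff_def p_pow_def algebra_simps)+

lemmas eval_simps = comult_op_def comult_def alg_hom_ext_letter rep_ext_letter rep_tensor_add rep_tensor_basis
  flip_add flip_basis eval_rep_gen eval_rep_one verma_gen_basis

text \<open>
  The simplifier prefers \<open>1\<close> to \<open>basis_vec 0\<close>. For the tensors in the comultiplication the opposite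
  direction is the useful one, because the lemmas on tensors speak of basis vectors.
\<close>
lemma one_free_alg: "(1 :: 'g free_alg) = basis_vec 0"
  by simp

abbreviation pair_rep where
  "pair_rep \<eta> k l x y \<equiv> rep_tensor (eval_rep \<eta> k x) (eval_rep \<eta> l y)"

lemma linear_op_scaleC: "linear_op (scaleC c)"
  by (rule linear_opI) (auto simp: scaleC_add mult.commute)

lemma linear_op_sumI: "(\<And>q. linear_op (F q)) \<Longrightarrow> linear_op (\<lambda>v. \<Sum>q\<in>A. F q v)"
  by (rule linear_opI)
    (simp_all add: linear_op_add linear_op_scale sum.distrib linear_op_sum[OF linear_op_scaleC])

lemma linear_op_rep_tensor: "linear_op (rep_tensor \<rho> \<sigma> T)"
proof -
  have "rep_tensor \<rho> \<sigma> T = (\<lambda>v. \<Sum>q\<in>Poly_Mapping.keys T. scaleC (Poly_Mapping.lookup T q)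
     (tensor_map (\<rho> (basis_vec (fst q))) (\<sigma> (basis_vec (snd q))) v))"
    by (simp add: fun_eq_iff rep_tensor_def lin_ext_def case_prod_beta)
  moreover have "linear_op \<dots>"
    by (rule linear_op_sumI, rule linear_op_compose[OF linear_op_scaleC linear_op_tensor_map, unfolded comp_def])
  ultimately show ?thesis by simp
qed

text \<open>
  The coefficients of \<open>f\<^sub>1\<close> under the comultiplication are those of \<open>e\<^sub>0\<close> under its opposite with \<open>x\<close>, \<open>y\<close>
  replaced by \<open>-x\<close>, \<open>-y\<close>, and likewise for \<open>f\<^sub>0\<close> and \<open>e\<^sub>1\<close>.
\<close>
lemma pair_rep_comult:
  "pair_rep \<eta> k l x y (comult (gen (GE N0)))
     = lowering (\<lambda>i j. exp (-x)) (\<lambda>i j. exp (-y) * cartan_coeff \<eta> 1 k i)"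
  "pair_rep \<eta> k l x y (comult (gen (GF N1)))
     = lowering (\<lambda>i j. exp x * cartan_coeff \<eta> 1 l j) (\<lambda>i j. exp y)"
  "pair_rep \<eta> k l x y (comult (gen (GE N1)))
     = raising (\<lambda>i j. exp (-x) * e_coeff \<eta> k i)
         (\<lambda>i j. exp (-y) * cartan_coeff \<eta> (-1) k i * e_coeff \<eta> l j)"
  "pair_rep \<eta> k l x y (comult (gen (GF N0)))
     = raising (\<lambda>i j. exp x * cartan_coeff \<eta> (-1) l j * e_coeff \<eta> k i)
         (\<lambda>i j. exp y * e_coeff \<eta> l j)"
  "pair_rep \<eta> k l x y (comult (gen (GP (0, c))))
     = diagonal (\<lambda>i j. cartan_coeff \<eta> c k i * cartan_coeff \<eta> c l j)"
  by (rule linear_op_eqI, rule linear_op_rep_tensor, simp, clarify,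
      simp add: eval_simps gen_def one_free_alg mult.commute mult.left_commute del: single_one)+

lemma pair_rep_comult_op:
  "pair_rep \<eta> k l x y (comult_op (gen (GE N0)))
     = lowering (\<lambda>i j. exp (-x) * cartan_coeff \<eta> 1 l j) (\<lambda>i j. exp (-y))"
  "pair_rep \<eta> k l x y (comult_op (gen (GF N1)))
     = lowering (\<lambda>i j. exp x) (\<lambda>i j. exp y * cartan_coeff \<eta> 1 k i)"
  "pair_rep \<eta> k l x y (comult_op (gen (GE N1)))
     = raising (\<lambda>i j. exp (-x) * cartan_coeff \<eta> (-1) l j * e_coeff \<eta> k i)
         (\<lambda>i j. exp (-y) * e_coeff \<eta> l j)"
  "pair_rep \<eta> k l x y (comult_op (gen (GF N0)))
     = raising (\<lambda>i j. exp x * e_coeff \<eta> k i)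
         (\<lambda>i j. exp y * cartan_coeff \<eta> (-1) k i * e_coeff \<eta> l j)"
  "pair_rep \<eta> k l x y (comult_op (gen (GP (0, c))))
     = diagonal (\<lambda>i j. cartan_coeff \<eta> c k i * cartan_coeff \<eta> c l j)"
  by (rule linear_op_eqI, rule linear_op_rep_tensor, simp, clarify,
      simp add: eval_simps gen_def one_free_alg mult.commute mult.left_commute del: single_one)+

lemma intertwines_gen:
  assumes "intertwines \<eta> k l x y T"
  shows "T (pair_rep \<eta> k l x y (comult X) v) = pair_rep \<eta> k l x y (comult_op X) (T v)"
proof -
  let ?C = "{(X, Y). X - Y \<in> aff_ideal \<eta>} `` {X}"
  have "?C \<in> quantum_affine_sl2 \<eta>"
    unfolding quantum_affine_sl2_def by (rule quotientI) simp
  moreover have "X \<in> ?C"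
    by (simp add: aff_ideal.zero)
  ultimately have "T \<circ> pair_rep \<eta> k l x y (comult X) = pair_rep \<eta> k l x y (comult_op X) \<circ> T"
    using assms[unfolded intertwines_def, rule_format, of ?C X] by simp
  then show ?thesis by (simp add: fun_eq_iff)
qed

section \<open>The coideal operators\<close>

text \<open>
  The coefficients of the lowering element \<open>\<alpha> f\<^sub>1 - \<alpha>\<^sup>-\<^sup>1 e\<^sub>0 p\<^bsup>h\<^sub>0\<^esup>\<close> and the raising element
  \<open>\<gamma> e\<^sub>1 p\<^bsup>h\<^sub>1\<^esup> - \<gamma>\<^sup>-\<^sup>1 f\<^sub>0\<close>, where \<open>\<alpha> = exp (\<xi> - \<eta> / 2)\<close> and \<open>\<gamma> = exp (\<xi> + \<eta> / 2)\<close>. The comultiplication of either is a sum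
  of two parts: in the tensor leg that belongs to the coideal subalgebra the coefficients are \<open>low_in\<close>,
  \<open>up_in\<close>, and they depend on that leg alone; in the other leg Cartan factors mix in the index of both
  legs, which gives \<open>low_out\<close>, \<open>up_out\<close>.
\<close>
definition low_in :: "complex \<Rightarrow> complex \<Rightarrow> complex \<Rightarrow> complex \<Rightarrow> nat \<Rightarrow> complex"
  where "low_in \<eta> \<xi> k x i =
    exp (\<xi> - \<eta> / 2 + x) - exp (- \<xi> + \<eta> / 2 - x - 2 * \<eta> * (k - of_nat i))"

definition low_out :: "complex \<Rightarrow> complex \<Rightarrow> complex \<Rightarrow> complex \<Rightarrow> complex \<Rightarrow> nat \<Rightarrow> nat \<Rightarrow> complex"
  where "low_out \<eta> \<xi> k l x i j =
    exp (\<xi> - \<eta> / 2 + x + 2 * \<eta> * (l - of_nat j))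
    - exp (- \<xi> + \<eta> / 2 - x - 2 * \<eta> * (k - of_nat i) - 2 * \<eta> * (l - of_nat j))"

definition up_in :: "complex \<Rightarrow> complex \<Rightarrow> complex \<Rightarrow> complex \<Rightarrow> nat \<Rightarrow> complex"
  where "up_in \<eta> \<xi> k x i = e_coeff \<eta> k i *
    (exp (\<xi> + \<eta> / 2 - x + 2 * \<eta> * (k - of_nat i)) - exp (- \<xi> - \<eta> / 2 + x))"

definition up_out :: "complex \<Rightarrow> complex \<Rightarrow> complex \<Rightarrow> complex \<Rightarrow> complex \<Rightarrow> nat \<Rightarrow> nat \<Rightarrow> complex"
  where "up_out \<eta> \<xi> k l x i j = e_coeff \<eta> k i *
    (exp (\<xi> + \<eta> / 2 - x + 2 * \<eta> * (k - of_nat i) + 2 * \<eta> * (l - of_nat j))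
     - exp (- \<xi> - \<eta> / 2 + x - 2 * \<eta> * (l - of_nat j)))"

text \<open>
  The coideal leg is the second one for the comultiplication and the first one for the opposite
  comultiplication; the suffix \<open>opp\<close> marks the latter.
\<close>
definition coideal_low where
  "coideal_low \<eta> \<xi> k l x y = lowering (\<lambda>i j. low_out \<eta> \<xi> k l x i j) (\<lambda>i j. low_in \<eta> \<xi> l y j)"

definition coideal_low_opp where
  "coideal_low_opp \<eta> \<xi> k l x y = lowering (\<lambda>i j. low_in \<eta> \<xi> k x i) (\<lambda>i j. low_out \<eta> \<xi> l k y j i)"

definition coideal_up where
  "coideal_up \<eta> \<xi> k l x y = raising (\<lambda>i j. up_out \<eta> \<xi> k l x i j) (\<lambda>i j. up_in \<eta> \<xi> l y j)"

definition coideal_up_opp where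
  "coideal_up_opp \<eta> \<xi> k l x y = raising (\<lambda>i j. up_in \<eta> \<xi> k x i) (\<lambda>i j. up_out \<eta> \<xi> l k y j i)"

definition cartan_op where
  "cartan_op \<eta> c k l = diagonal (\<lambda>i j. cartan_coeff \<eta> c k i * cartan_coeff \<eta> c l j)"

lemma linear_op_coideal [simp]:
  "linear_op (coideal_low \<eta> \<xi> k l x y)" "linear_op (coideal_low_opp \<eta> \<xi> k l x y)"
  "linear_op (coideal_up \<eta> \<xi> k l x y)" "linear_op (coideal_up_opp \<eta> \<xi> k l x y)" "linear_op (cartan_op \<eta> c k l)"
  by (simp_all add: coideal_low_def coideal_low_opp_def coideal_up_def coideal_up_opp_def cartan_op_def)

lemma lowering_comb:
  "scaleC s (lowering a b v) + scaleC t (lowering a' b' (diagonal d v))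
     = lowering (\<lambda>i j. s * a i j + t * d i j * a' i j) (\<lambda>i j. s * b i j + t * d i j * b' i j) v"
  and raising_comb:
  "scaleC s (raising a b v) + scaleC t (raising a' b' (diagonal d v))
     = raising (\<lambda>i j. s * a i j + t * d i j * a' i j) (\<lambda>i j. s * b i j + t * d i j * b' i j) v"
  by (rule fun_cong[where x = v, OF linear_op_eqI],
      rule linear_op_comb[OF _ linear_op_compose[unfolded comp_def]];
      auto simp: scaleC_add single_add algebra_simps)+

lemma diagonal_lowering:
  "diagonal t (lowering a b v)
     = lowering (\<lambda>i j. t (Suc i) j * a i j) (\<lambda>i j. t i (Suc j) * b i j) v"
  and lowering_diagonal:
  "lowering a b (diagonal t v) = lowering (\<lambda>i j. t i j * a i j) (\<lambda>i j. t i j * b i j) v"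
  and diagonal_raising:
  "diagonal t (raising a b v)
     = raising (\<lambda>i j. t (i - 1) j * a i j) (\<lambda>i j. t i (j - 1) * b i j) v"
  and raising_diagonal:
  "raising a b (diagonal t v) = raising (\<lambda>i j. t i j * a i j) (\<lambda>i j. t i j * b i j) v"
  by (rule fun_cong[where x = v, OF linear_op_eqI[OF linear_op_compose[unfolded comp_def]]];
      auto simp: linear_op_add[OF linear_op_ladder(3)] mult.commute)+

lemma coideal_low_eq:
  "coideal_low \<eta> \<xi> k l x y v
   = scaleC (exp (\<xi> - \<eta> / 2))
       (lowering (\<lambda>i j. exp x * cartan_coeff \<eta> 1 l j) (\<lambda>i j. exp y) v)
   + scaleC (- exp (- \<xi> + \<eta> / 2))
       (lowering (\<lambda>i j. exp (-x)) (\<lambda>i j. exp (-y) * cartan_coeff \<eta> 1 k i) (cartan_op \<eta> (-1) k l v))"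
  unfolding coideal_low_def cartan_op_def lowering_comb
  by (rule arg_cong2[where f = "\<lambda>a b. lowering a b v"])
    (auto simp: fun_eq_iff low_in_def low_out_def cartan_coeff_def mult_exp_exp algebra_simps)

lemma coideal_low_opp_eq:
  "coideal_low_opp \<eta> \<xi> k l x y v
   = scaleC (exp (\<xi> - \<eta> / 2))
       (lowering (\<lambda>i j. exp x) (\<lambda>i j. exp y * cartan_coeff \<eta> 1 k i) v)
   + scaleC (- exp (- \<xi> + \<eta> / 2))
       (lowering (\<lambda>i j. exp (-x) * cartan_coeff \<eta> 1 l j) (\<lambda>i j. exp (-y)) (cartan_op \<eta> (-1) k l v))"
  unfolding coideal_low_opp_def cartan_op_def lowering_comb
  by (rule arg_cong2[where f = "\<lambda>a b. lowering a b v"])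
    (auto simp: fun_eq_iff low_in_def low_out_def cartan_coeff_def mult_exp_exp algebra_simps)

lemma coideal_up_eq:
  "coideal_up \<eta> \<xi> k l x y v
   = scaleC (- exp (- \<xi> - \<eta> / 2))
       (raising (\<lambda>i j. exp x * cartan_coeff \<eta> (-1) l j * e_coeff \<eta> k i)
          (\<lambda>i j. exp y * e_coeff \<eta> l j) v)
   + scaleC (exp (\<xi> + \<eta> / 2))
       (raising (\<lambda>i j. exp (-x) * e_coeff \<eta> k i)
          (\<lambda>i j. exp (-y) * cartan_coeff \<eta> (-1) k i * e_coeff \<eta> l j) (cartan_op \<eta> 1 k l v))"
  unfolding coideal_up_def cartan_op_def raising_comb
  by (rule arg_cong2[where f = "\<lambda>a b. raising a b v"])
    (auto simp: fun_eq_iff up_in_def up_out_def cartan_coeff_def mult_exp_exp algebra_simps)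

lemma coideal_up_opp_eq:
  "coideal_up_opp \<eta> \<xi> k l x y v
   = scaleC (- exp (- \<xi> - \<eta> / 2))
       (raising (\<lambda>i j. exp x * e_coeff \<eta> k i)
          (\<lambda>i j. exp y * cartan_coeff \<eta> (-1) k i * e_coeff \<eta> l j) v)
   + scaleC (exp (\<xi> + \<eta> / 2))
       (raising (\<lambda>i j. exp (-x) * cartan_coeff \<eta> (-1) l j * e_coeff \<eta> k i)
          (\<lambda>i j. exp (-y) * e_coeff \<eta> l j) (cartan_op \<eta> 1 k l v))"
  unfolding coideal_up_opp_def cartan_op_def raising_comb
  by (rule arg_cong2[where f = "\<lambda>a b. raising a b v"])
    (auto simp: fun_eq_iff up_in_def up_out_def cartan_coeff_def mult_exp_exp algebra_simps)

lemma intertwines_cartan: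
  assumes "intertwines \<eta> k l x y T"
  shows "T (cartan_op \<eta> c k l v) = cartan_op \<eta> c k l (T v)"
  using intertwines_gen[OF assms, of "gen (GP (0, c))"]
  by (simp add: pair_rep_comult pair_rep_comult_op cartan_op_def)

text \<open>
  The second and fourth relations use the operator at the parameters \<open>(-x, -y)\<close> although it intertwines
  the comultiplications at \<open>(x, y)\<close>. Negating \<open>x\<close> and \<open>y\<close> exchanges the contributions of \<open>f\<^sub>1\<close> and \<open>e\<^sub>0\<close>, and of
  \<open>e\<^sub>1\<close> and \<open>f\<^sub>0\<close>, together with the comultiplication and its opposite, so the relations for the
  generators are the same four.
\<close>
lemma intertwines_coideal:
  assumes "linear_op T" "intertwines \<eta> k l x y T"
  shows "T (coideal_low \<eta> \<xi> k l x y v) = coideal_low_opp \<eta> \<xi> k l x y (T v)"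
    and "T (coideal_low_opp \<eta> \<xi> k l (-x) (-y) v) = coideal_low \<eta> \<xi> k l (-x) (-y) (T v)"
    and "T (coideal_up \<eta> \<xi> k l x y v) = coideal_up_opp \<eta> \<xi> k l x y (T v)"
    and "T (coideal_up_opp \<eta> \<xi> k l (-x) (-y) v) = coideal_up \<eta> \<xi> k l (-x) (-y) (T v)"
proof -
  note gens = intertwines_gen[OF assms(2), of "gen (GE N0)"] intertwines_gen[OF assms(2), of "gen (GE N1)"]
    intertwines_gen[OF assms(2), of "gen (GF N0)"] intertwines_gen[OF assms(2), of "gen (GF N1)"]
  show "T (coideal_low \<eta> \<xi> k l x y v) = coideal_low_opp \<eta> \<xi> k l x y (T v)"
    and "T (coideal_low_opp \<eta> \<xi> k l (-x) (-y) v) = coideal_low \<eta> \<xi> k l (-x) (-y) (T v)"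
    and "T (coideal_up \<eta> \<xi> k l x y v) = coideal_up_opp \<eta> \<xi> k l x y (T v)"
    and "T (coideal_up_opp \<eta> \<xi> k l (-x) (-y) v) = coideal_up \<eta> \<xi> k l (-x) (-y) (T v)"
    by (simp_all add: coideal_low_eq coideal_low_opp_eq coideal_up_eq coideal_up_opp_eq
      linear_op_add[OF assms(1)] linear_op_scale[OF assms(1)]
      gens[unfolded pair_rep_comult pair_rep_comult_op] intertwines_cartan[OF assms(2)])
qed

section \<open>The K-operators intertwine the coideal operators\<close>

lemma low_in_sinh:
  "low_in \<eta> \<xi> k x i = 2 * exp (- \<eta> * (k - of_nat i)) * sinh (\<xi> + x + (k - 1 / 2 - of_nat i) * \<eta>)"
  by (simp add: low_in_def sinh_field_def mult_exp_exp algebra_simps)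

lemma up_in_sinh:
  "up_in \<eta> \<xi> k x i = e_coeff \<eta> k i *
     (2 * exp (\<eta> * (k - of_nat i)) * sinh (\<xi> - x + (k + 1 / 2 - of_nat i) * \<eta>))"
  by (simp add: up_in_def sinh_field_def mult_exp_exp algebra_simps)

text \<open>By \<open>low_in_sinh\<close> this says that no denominator in the product for the K-operator vanishes.\<close>
abbreviation K_regular :: "complex \<Rightarrow> complex \<Rightarrow> complex \<Rightarrow> complex \<Rightarrow> bool"
  where "K_regular \<eta> \<xi> k x \<equiv> \<forall>i::nat. low_in \<eta> \<xi> k x i \<noteq> 0"

lemma K_coeff_Suc:
  assumes "low_in \<eta> \<xi> k x i \<noteq> 0"
  shows "K_coeff \<eta> \<xi> k (Suc (Suc i)) x * low_in \<eta> \<xi> k x i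
    = K_coeff \<eta> \<xi> k (Suc i) x * low_in \<eta> \<xi> k (-x) i"
proof -
  have "K_coeff \<eta> \<xi> k (Suc (Suc i)) x = K_coeff \<eta> \<xi> k (Suc i) x *
      (sinh (\<xi> - x + (k - 1 / 2 - of_nat i) * \<eta>) / sinh (\<xi> + x + (k - 1 / 2 - of_nat i) * \<eta>))"
    by (simp add: K_coeff_def algebra_simps)
  then show ?thesis
    using assms by (simp add: low_in_sinh)
qed

lemma K_coeff_up:
  assumes "K_regular \<eta> \<xi> k x"
  shows "K_coeff \<eta> \<xi> k (Suc (i - 1)) x * up_in \<eta> \<xi> k x i
    = K_coeff \<eta> \<xi> k (Suc i) x * up_in \<eta> \<xi> k (-x) i"
proof (cases i)
  case 0
  then show ?thesis by (simp add: up_in_def)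
next
  case (Suc n)
  have sh: "(k + 1 / 2 - of_nat i) * \<eta> = (k - 1 / 2 - of_nat n) * \<eta>"
    using Suc by (simp add: algebra_simps)
  have "sinh (\<xi> + x + (k - 1 / 2 - of_nat n) * \<eta>) \<noteq> 0"
    using assms by (simp add: low_in_sinh)
  with K_coeff_Suc[OF assms[rule_format, of n]] show ?thesis
    unfolding up_in_sinh sh by (simp add: Suc low_in_sinh mult.commute)
qed

lemma K1_op_diagonal: "K1_op \<eta> \<xi> k x = diagonal (\<lambda>i j. K_coeff \<eta> \<xi> k (Suc i) x)"
  and K2_op_diagonal: "K2_op \<eta> \<xi> l y = diagonal (\<lambda>i j. K_coeff \<eta> \<xi> l (Suc j) y)"
  by (rule linear_op_eqI; auto simp: K1_op_def K2_op_def K_op_def verma_op_def mvec_def)+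

lemma K1_coideal:
  assumes "K_regular \<eta> \<xi> k x"
  shows "K1_op \<eta> \<xi> k x (coideal_low_opp \<eta> \<xi> k l x y v) = coideal_low_opp \<eta> \<xi> k l (-x) y (K1_op \<eta> \<xi> k x v)"
    and "K1_op \<eta> \<xi> k x (coideal_up_opp \<eta> \<xi> k l x y v) = coideal_up_opp \<eta> \<xi> k l (-x) y (K1_op \<eta> \<xi> k x v)"
  unfolding K1_op_diagonal coideal_low_opp_def coideal_up_opp_def diagonal_lowering lowering_diagonal
    diagonal_raising raising_diagonal
  by (rule arg_cong2[where f = "\<lambda>a b. lowering a b v"] arg_cong2[where f = "\<lambda>a b. raising a b v"];
      use assms in \<open>simp add: fun_eq_iff K_coeff_Suc K_coeff_up[unfolded One_nat_def]\<close>)+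

lemma K2_coideal:
  assumes "K_regular \<eta> \<xi> l y"
  shows "K2_op \<eta> \<xi> l y (coideal_low \<eta> \<xi> k l x y v) = coideal_low \<eta> \<xi> k l x (-y) (K2_op \<eta> \<xi> l y v)"
    and "K2_op \<eta> \<xi> l y (coideal_up \<eta> \<xi> k l x y v) = coideal_up \<eta> \<xi> k l x (-y) (K2_op \<eta> \<xi> l y v)"
  unfolding K2_op_diagonal coideal_low_def coideal_up_def diagonal_lowering lowering_diagonal
    diagonal_raising raising_diagonal
  by (rule arg_cong2[where f = "\<lambda>a b. lowering a b v"] arg_cong2[where f = "\<lambda>a b. raising a b v"];
      use assms in \<open>simp add: fun_eq_iff K_coeff_Suc K_coeff_up[unfolded One_nat_def]\<close>)+

text \<open>
  The evaluation parameters travel from \<open>(x, y)\<close> to \<open>(-x, -y)\<close> along both sides, in the order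
  \<open>(x, -y)\<close>, \<open>(-x, -y)\<close> on the one and \<open>(-x, y)\<close>, \<open>(-x, -y)\<close> on the other. Each K-operator flips the sign of one
  parameter, and each R-operator switches between the comultiplication and its opposite.
\<close>
lemma reflection_sides_coideal:
  assumes S: "linear_op S" "intertwines \<eta> k l x y S"
    and T: "linear_op T" "intertwines \<eta> k l x (-y) T"
    and K: "K_regular \<eta> \<xi> k x" "K_regular \<eta> \<xi> l y"
  defines "A \<equiv> S \<circ> K1_op \<eta> \<xi> k x \<circ> T \<circ> K2_op \<eta> \<xi> l y"
    and "B \<equiv> K2_op \<eta> \<xi> l y \<circ> T \<circ> K1_op \<eta> \<xi> k x \<circ> S"
  shows "A (coideal_low \<eta> \<xi> k l x y v) = coideal_low \<eta> \<xi> k l (-x) (-y) (A v)"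
    and "A (coideal_up \<eta> \<xi> k l x y v) = coideal_up \<eta> \<xi> k l (-x) (-y) (A v)"
    and "B (coideal_low \<eta> \<xi> k l x y v) = coideal_low \<eta> \<xi> k l (-x) (-y) (B v)"
    and "B (coideal_up \<eta> \<xi> k l x y v) = coideal_up \<eta> \<xi> k l (-x) (-y) (B v)"
  using intertwines_coideal[OF S] intertwines_coideal[OF T]
  by (simp_all add: A_def B_def K1_coideal[OF K(1)] K2_coideal[OF K(2)])

section \<open>Cyclicity of the vacuum\<close>

text \<open>
  For \<open>X = lowering a (\<lambda>i. b)\<close> and \<open>Y = raising c (\<lambda>i. d)\<close> and modulo the image of \<open>X\<close>, the
  vector \<open>Y X\<^sup>2 (m\<^sub>0 \<otimes> m\<^sub>n)\<close> is a multiple of \<open>m\<^sub>0 \<otimes> m\<^sub>n\<^sub>+\<^sub>1\<close> (basis vectors numbered from 0); the following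
  expression is that multiple, up to the factor \<open>a 0 n * a 1 (n - 1)\<close> that clears denominators. The
  truncated difference \<open>n - 1\<close> is harmless: for \<open>n = 0\<close> the terms that would need the index \<open>-1\<close> are
  multiplied by \<open>d 0 = 0\<close>, and elsewhere \<open>a 1 (n - 1)\<close> is only a common nonzero factor.
\<close>
abbreviation cyclic_det where
  "cyclic_det a b c d n \<equiv>
     (a 0 n * b n + b n * a 0 (Suc n)) * c 1 (Suc n) * a 0 n * a 1 (n - 1)
     + b n * b (Suc n) * d (n + 2) * a 0 n * a 1 (n - 1)
     - (a 0 n * a 1 n * c 2 n + (a 0 n * b n + b n * a 0 (Suc n)) * d (Suc n)) * b n * a 1 (n - 1)
     + a 0 n * a 1 n * d n * b n * b (n - 1)"

text \<open>
  An operator \<open>D\<close> that carries \<open>X\<close> and \<open>Y\<close> to some other operators and kills the vacuum is zero, because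
  the vacuum generates everything. This goes by induction on the weight. If \<open>D\<close> kills weight \<open>n\<close>, then it
  kills the image of \<open>X\<close>, which has codimension one in weight \<open>n + 1\<close>: all \<open>D (m\<^sub>i \<otimes> m\<^sub>n\<^sub>+\<^sub>1\<^sub>-\<^sub>i)\<close> are
  multiples of \<open>D (m\<^sub>0 \<otimes> m\<^sub>n\<^sub>+\<^sub>1)\<close>. It also kills \<open>Y X\<^sup>2 (m\<^sub>0 \<otimes> m\<^sub>n)\<close>, and this supplies the missing
  direction as soon as the determinant above does not vanish.
\<close>
lemma vacuum_cyclic:
  fixes a c :: "nat \<Rightarrow> nat \<Rightarrow> complex" and b d :: "nat \<Rightarrow> complex"
    and D X' Y' :: "verma2 \<Rightarrow> verma2"
  defines "X \<equiv> lowering a (\<lambda>i. b)" and "Y \<equiv> raising c (\<lambda>i. d)"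
  assumes D: "linear_op D" "linear_op X'" "linear_op Y'"
    and DX: "\<And>v. D (X v) = X' (D v)" and DY: "\<And>v. D (Y v) = Y' (D v)"
    and vac: "D (basis_vec (0, 0)) = 0"
    and cd0: "\<And>j. c 0 j = 0" "d 0 = 0"
    and a: "\<And>i j. a i j \<noteq> 0"
    and det: "\<And>n. cyclic_det a b c d n \<noteq> 0"
  shows "D = (\<lambda>v. 0)"
proof -
  note lin = linear_op_add[OF D(1)] linear_op_scale[OF D(1)]
  have D_single: "D (Poly_Mapping.single q s) = scaleC s (D (basis_vec q))" for q s
    by (simp flip: lin(2))
  have level: "D (basis_vec (i, j)) = 0" if "i + j = n" for i j n
    using that
  proof (induction n arbitrary: i j)
    case 0
    then show ?case using vac by simp
  next
    case (Suc n)
    let ?z = "D (basis_vec (0, Suc n))"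
    have X_zero: "D (X (basis_vec (i, j))) = 0" if "i + j = n" for i j
      using Suc.IH[OF that] by (simp add: DX linear_op_zero[OF D(2)])
    have shift: "D (basis_vec (Suc i, j)) = scaleC (- (b j / a i j)) (D (basis_vec (i, Suc j)))"
      if "i + j = n" for i j
    proof -
      have "scaleC (1 / a i j) (scaleC (a i j) (D (basis_vec (Suc i, j)))
          + scaleC (b j) (D (basis_vec (i, Suc j)))) = 0"
        using X_zero[OF that] by (simp add: X_def lin D_single[of _ "a _ _"] D_single[of _ "b _"])
      then have "D (basis_vec (Suc i, j)) + scaleC (b j / a i j) (D (basis_vec (i, Suc j))) = 0"
        using a by (simp add: scaleC_add)
      then show ?thesis by (simp add: eq_neg_iff_add_eq_0[symmetric] scaleC_minus)
    qed
    \<comment> \<open>\<open>Y X\<^sup>2 w\<close> has components at \<open>(0, n + 1)\<close>, \<open>(1, n)\<close>, \<open>(2, n - 1)\<close>; \<open>shift\<close> reduces the last two to the first.\<close>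
    have z_zero: "?z = 0"
    proof -
      define f where "f = (a 0 n * b n + b n * a 0 (Suc n)) * c 1 (Suc n)
        + b n * b (Suc n) * d (n + 2)"
      define g where "g = a 0 n * a 1 n * c 2 n + (a 0 n * b n + b n * a 0 (Suc n)) * d (Suc n)"
      have "D (Y (X (X (basis_vec (0, n))))) = 0"
        by (simp add: DX DY Suc.IH linear_op_zero[OF D(2)] linear_op_zero[OF D(3)])
      moreover have "Y (X (X (basis_vec (0, n)))) = Poly_Mapping.single (0, Suc n) f
          + Poly_Mapping.single (1, n) g + Poly_Mapping.single (2, n - 1) (a 0 n * a 1 n * d n)"
        by (simp add: X_def Y_def cd0 linear_op_add[OF linear_op_ladder(1)]
           linear_op_add[OF linear_op_ladder(2)] f_def g_def single_add algebra_simps numeral_2_eq_2)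
      ultimately have rel: "scaleC f ?z + scaleC g (D (basis_vec (1, n)))
          + scaleC (a 0 n * a 1 n * d n) (D (basis_vec (2, n - 1))) = 0"
        by (simp add: lin D_single[of _ f] D_single[of _ g] D_single[of _ "a 0 n * a (Suc 0) n * d n"])
      have one: "D (basis_vec (1, n)) = scaleC (- (b n / a 0 n)) ?z"
        using shift[of 0 n] by simp
      have two: "scaleC (d n) (D (basis_vec (2, n - 1)))
          = scaleC (d n * (b (n - 1) / a 1 (n - 1)) * (b n / a 0 n)) ?z"
      proof (cases n)
        case 0
        then show ?thesis by (simp add: cd0)
      next
        case (Suc m)
        then have "D (basis_vec (2, m)) = scaleC (- (b m / a 1 m)) (D (basis_vec (1, n)))"
          using shift[of 1 m] by (simp add: numeral_2_eq_2)
        then show ?thesis using one Suc by (simp add: mult.assoc)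
      qed
      have "scaleC (a 0 n * a 1 n * d n) (D (basis_vec (2, n - 1)))
          = scaleC (a 0 n * a 1 n) (scaleC (d n) (D (basis_vec (2, n - 1))))"
        by simp
      with rel have "scaleC (f - g * (b n / a 0 n)
          + a 0 n * a 1 n * (d n * (b (n - 1) / a 1 (n - 1)) * (b n / a 0 n))) ?z = 0"
        unfolding one two by (simp add: scaleC_left_add[symmetric])
      moreover have "f - g * (b n / a 0 n)
          + a 0 n * a 1 n * (d n * (b (n - 1) / a 1 (n - 1)) * (b n / a 0 n)) \<noteq> 0"
        using det[of n] a unfolding f_def[symmetric] g_def[symmetric]
        by (simp add: field_simps f_def g_def)
      moreover have "scaleC s v = 0 \<Longrightarrow> s \<noteq> 0 \<Longrightarrow> v = 0" for s and v :: verma2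
        using scaleC_scaleC[of "1 / s" s v] by simp
      ultimately show ?thesis by blast
    qed
    have "\<forall>j. i + j = Suc n \<longrightarrow> D (basis_vec (i, j)) = 0" for i
      by (induction i) (auto simp: z_zero shift)
    then show ?case using Suc.prems by blast
  qed
  have "linear_op (\<lambda>v::verma2. 0 :: verma2)"
    by (rule linear_opI) auto
  then show ?thesis
    by (rule linear_op_eqI[OF D(1)]) (auto intro: level)
qed

section \<open>Generic parameters\<close>

lemma countable_exp_eq: "countable {x::complex. exp (- 2 * x) = r}"
proof (cases "r = 0")
  case True
  then show ?thesis by simp
next
  case False
  have "{x. exp (- 2 * x) = r}
      \<subseteq> range (\<lambda>n::int. - (Ln r + of_real (of_int (2 * n) * pi) * \<i>) / 2)"
  proof
    fix x assume "x \<in> {x. exp (- 2 * x) = r}"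
    then have "exp (- 2 * x) = exp (Ln r)" using False by simp
    then obtain n :: int where n: "- 2 * x = Ln r + of_real (of_int (2 * n) * pi) * \<i>"
      unfolding exp_eq by blast
    have "x = - (- 2 * x) / 2" by simp
    also have "\<dots> = - (Ln r + of_real (of_int (2 * n) * pi) * \<i>) / 2" by (simp only: n)
    finally have "x = - (Ln r + of_real (of_int (2 * n) * pi) * \<i>) / 2" .
    then show "x \<in> range (\<lambda>n::int. - (Ln r + of_real (of_int (2 * n) * pi) * \<i>) / 2)" by blast
  qed
  then show ?thesis by (rule countable_subset) simp
qed

lemma countable_exp_poly_zeros:
  fixes P :: "complex poly"
  assumes "P \<noteq> 0"
  shows "countable {x. poly P (exp (- 2 * x)) = 0}"
proof -
  have "{x. poly P (exp (- 2 * x)) = 0} = (\<Union>r\<in>{r. poly P r = 0}. {x. exp (- 2 * x) = r})"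
    by auto
  then show ?thesis
    using poly_roots_finite[OF assms, THEN countable_finite] countable_exp_eq by (simp only: countable_UN)
qed

definition low_in_poly :: "complex \<Rightarrow> complex \<Rightarrow> complex \<Rightarrow> nat \<Rightarrow> complex poly"
  where "low_in_poly \<eta> \<xi> k i =
    [: exp (\<xi> - \<eta> / 2), - exp (- \<xi> + \<eta> / 2 - 2 * \<eta> * (k - of_nat i)) :]"

definition low_poly :: "complex \<Rightarrow> complex \<Rightarrow> complex \<Rightarrow> complex \<Rightarrow> nat \<Rightarrow> nat \<Rightarrow> complex poly"
  where "low_poly \<eta> \<xi> k l i j =
    [: exp (\<xi> - \<eta> / 2 + 2 * \<eta> * (l - of_nat j)),
       - exp (- \<xi> + \<eta> / 2 - 2 * \<eta> * (k - of_nat i) - 2 * \<eta> * (l - of_nat j)) :]"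

definition up_poly :: "complex \<Rightarrow> complex \<Rightarrow> complex \<Rightarrow> complex \<Rightarrow> nat \<Rightarrow> nat \<Rightarrow> complex poly"
  where "up_poly \<eta> \<xi> k l i j = smult (e_coeff \<eta> k i)
    [: - exp (- \<xi> - \<eta> / 2 - 2 * \<eta> * (l - of_nat j)),
       exp (\<xi> + \<eta> / 2 + 2 * \<eta> * (k - of_nat i) + 2 * \<eta> * (l - of_nat j)) :]"

text \<open>
  Up to a factor \<open>exp x\<close>, the coefficients are affine in \<open>exp (- 2 * x)\<close>. The constant terms describe the
  regime in which the real part of \<open>x\<close> is large.
\<close>
lemma low_in_poly: "low_in \<eta> \<xi> k x i = exp x * poly (low_in_poly \<eta> \<xi> k i) (exp (- 2 * x))"
  and low_poly: "low_out \<eta> \<xi> k l x i j = exp x * poly (low_poly \<eta> \<xi> k l i j) (exp (- 2 * x))"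
  and up_poly: "up_out \<eta> \<xi> k l x i j = exp x * poly (up_poly \<eta> \<xi> k l i j) (exp (- 2 * x))"
proof -
  have u: "exp (- 2 * x) = 1 / (exp x * exp x)"
    by (simp add: exp_minus mult_exp_exp field_simps)
  show "low_in \<eta> \<xi> k x i = exp x * poly (low_in_poly \<eta> \<xi> k i) (exp (- 2 * x))"
    and "low_out \<eta> \<xi> k l x i j = exp x * poly (low_poly \<eta> \<xi> k l i j) (exp (- 2 * x))"
    and "up_out \<eta> \<xi> k l x i j = exp x * poly (up_poly \<eta> \<xi> k l i j) (exp (- 2 * x))"
    unfolding u low_in_def low_in_poly_def low_out_def low_poly_def up_out_def up_poly_def
      exp_add exp_diff exp_minus
    by (simp_all add: divide_simps) (simp_all add: algebra_simps)
qed

text \<open>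
  The difference of the two sides is \<open>2 * cosh \<eta> * exp (2 * k * \<eta>)\<close>: the dependence on \<open>k\<close> is a factor
  without zeros, so that no value of \<open>k\<close> has to be excluded.
\<close>
lemma e_coeff_step:
  assumes "exp (\<eta>::complex) ^ 4 \<noteq> 1"
  shows "(1 + exp (2 * \<eta>)) * e_coeff \<eta> k 1 \<noteq> e_coeff \<eta> k 2"
proof -
  define p Q where "p = exp \<eta>" and "Q = exp (2 * k * \<eta>)"
  have nz: "p \<noteq> 0" "Q \<noteq> 0" by (auto simp: p_def Q_def)
  have s1: "sinh \<eta> = (p - 1 / p) / 2"
    by (simp add: sinh_field_def p_def exp_minus field_simps)
  have s2: "sinh (2 * \<eta>) = (p\<^sup>2 - 1 / p\<^sup>2) / 2"
    unfolding sinh_field_def exp_minus exp_double p_def inverse_eq_divide ..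
  have s3: "sinh (2 * k * \<eta>) = (Q - 1 / Q) / 2"
    by (simp add: sinh_field_def Q_def exp_minus field_simps)
  have s4: "sinh ((2 * k - 1) * \<eta>) = (Q / p - p / Q) / 2"
    by (simp add: sinh_field_def p_def Q_def exp_minus exp_diff left_diff_distrib field_simps)
  have "p\<^sup>2 \<noteq> 1"
  proof
    assume "p\<^sup>2 = 1"
    then have "(p\<^sup>2)\<^sup>2 = 1" by simp
    then show False using assms by (simp add: p_def flip: power_mult)
  qed
  have diff: "(1 + exp (2 * \<eta>)) * (sinh \<eta> * sinh (2 * k * \<eta>)) - sinh (2 * \<eta>) * sinh ((2 * k - 1) * \<eta>)
      = (p - 1 / p) * Q * (p\<^sup>2 - 1 / p\<^sup>2) / 4"
    unfolding s1 s2 s3 s4 exp_double p_def[symmetric] using nz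
    by (simp add: field_simps power2_eq_square)
  have "p - 1 / p \<noteq> 0"
    using \<open>p\<^sup>2 \<noteq> 1\<close> nz by (simp add: field_simps power2_eq_square)
  moreover have "p\<^sup>2 - 1 / p\<^sup>2 \<noteq> 0"
    using assms nz by (simp add: field_simps p_def flip: power_add)
  ultimately have "(p - 1 / p) * Q * (p\<^sup>2 - 1 / p\<^sup>2) / 4 \<noteq> 0"
    using nz by simp
  with diff have "(1 + exp (2 * \<eta>)) * (sinh \<eta> * sinh (2 * k * \<eta>)) - sinh (2 * \<eta>) * sinh ((2 * k - 1) * \<eta>) \<noteq> 0"
    by (simp only: not_False_eq_True)
  moreover have "sinh \<eta> \<noteq> 0"
    using \<open>p - 1 / p \<noteq> 0\<close> unfolding s1 by (metis divide_eq_0_iff zero_neq_numeral)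
  ultimately show ?thesis
    by (auto simp: e_coeff_def field_simps)
qed

lemma cyclic_det_scale:
  fixes s u :: complex
  assumes "s\<^sup>2 * u = 1"
  shows "cyclic_det (\<lambda>i j. s * A i j) b (\<lambda>i j. s * C i j) d n = s ^ 4 *
       (b n * ((A 0 n + A 0 (Suc n)) * C 1 (Suc n) * A 0 n * A 1 (n - 1))
       + b n * b (Suc n) * d (n + 2) * (u * A 0 n * A 1 (n - 1))
       - b n * ((A 0 n * A 1 n * C 2 n + b n * d (Suc n) * (u * (A 0 n + A 0 (Suc n)))) * A 1 (n - 1))
       + d n * b n * b (n - 1) * (u * A 0 n * A 1 n))" (is "?l = ?r")
proof -
  have *: "s ^ 4 * u = s\<^sup>2"
    using assms by (simp add: power4_eq_xxxx power2_eq_square mult.assoc)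
  have "?r = s ^ 4 * (b n * (A 0 n + A 0 (Suc n)) * C 1 (Suc n) * A 0 n * A 1 (n - 1)
       - b n * A 0 n * A 1 n * C 2 n * A 1 (n - 1))
     + (s ^ 4 * u) * (b n * b (Suc n) * d (n + 2) * A 0 n * A 1 (n - 1)
       - b n * b n * d (Suc n) * (A 0 n + A 0 (Suc n)) * A 1 (n - 1)
       + d n * b n * b (n - 1) * A 0 n * A 1 n)"
    by (simp add: algebra_simps)
  also have "\<dots> = ?l"
    unfolding * by (simp add: algebra_simps power4_eq_xxxx power2_eq_square)
  finally show ?thesis ..
qed

text \<open>
  By \<open>cyclic_det_scale\<close>, the determinant is \<open>exp x ^ 4\<close> times a polynomial in \<open>u = exp (- 2 * x)\<close>. At \<open>u = 0\<close> only the
  products with one factor \<open>c\<close> survive, and they combine to a nonzero multiple of \<open>b n\<close> by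
  \<open>e_coeff_step\<close>.
\<close>
lemma countable_cyclic_det_zeros:
  fixes b d :: "nat \<Rightarrow> complex"
  assumes "exp (\<eta>::complex) ^ 4 \<noteq> 1" "b n \<noteq> 0"
  shows "countable {x. cyclic_det (low_out \<eta> \<xi> k l x) b (up_out \<eta> \<xi> k l x) d n = (0::complex)}"
proof -
  let ?a = "low_poly \<eta> \<xi> k l" and ?c = "up_poly \<eta> \<xi> k l" and ?u = "[:0, 1:]"
  define P where "P =
     smult (b n) ((?a 0 n + ?a 0 (Suc n)) * ?c 1 (Suc n) * ?a 0 n * ?a 1 (n - 1))
     + smult (b n * b (Suc n) * d (n + 2)) (?u * ?a 0 n * ?a 1 (n - 1))
     - smult (b n) ((?a 0 n * ?a 1 n * ?c 2 n
         + smult (b n * d (Suc n)) (?u * (?a 0 n + ?a 0 (Suc n)))) * ?a 1 (n - 1))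
     + smult (d n * b n * b (n - 1)) (?u * ?a 0 n * ?a 1 n)"
  (* leading values: poly (?a i j) 0 and poly (?c i j) 0 are alpha * kappa and - e * delta / kappa,
     with kappa divided by p^2 when j increases by one *)
  define \<kappa> \<alpha> \<delta> where "\<kappa> = exp (2 * \<eta> * (l - of_nat n))" and "\<alpha> = exp (\<xi> - \<eta> / 2)"
    and "\<delta> = exp (- \<xi> - \<eta> / 2)"
  have nz: "\<kappa> \<noteq> 0" "\<alpha> \<noteq> 0" "\<delta> \<noteq> 0" "exp (2 * \<eta>) \<noteq> 0"
    by (auto simp: \<kappa>_def \<alpha>_def \<delta>_def)
  have shift: "2 * \<eta> * (l - of_nat (Suc n)) = 2 * \<eta> * (l - of_nat n) - 2 * \<eta>"
    by (simp add: algebra_simps)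
  have "poly (?a i j) 0 = \<alpha> * exp (2 * \<eta> * (l - of_nat j))"
    "poly (?c i j) 0 = - e_coeff \<eta> k i * \<delta> / exp (2 * \<eta> * (l - of_nat j))" for i j
    unfolding low_poly_def up_poly_def \<alpha>_def \<delta>_def exp_add exp_diff by simp_all
  then have "poly (?a i n) 0 = \<alpha> * \<kappa>" "poly (?a i (Suc n)) 0 = \<alpha> * \<kappa> / exp (2 * \<eta>)"
    "poly (?c i n) 0 = - e_coeff \<eta> k i * \<delta> / \<kappa>"
    "poly (?c i (Suc n)) 0 = - e_coeff \<eta> k i * \<delta> * exp (2 * \<eta>) / \<kappa>" for i
    by (simp_all only: shift exp_diff flip: \<kappa>_def) simp_all
  moreover have "poly P 0 = b n * poly (?a 1 (n - 1)) 0 * poly (?a 0 n) 0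
      * ((poly (?a 0 n) 0 + poly (?a 0 (Suc n)) 0) * poly (?c 1 (Suc n)) 0
         - poly (?a 1 n) 0 * poly (?c 2 n) 0)"
    by (simp add: P_def algebra_simps)
  ultimately have "poly P 0 = b n * poly (?a 1 (n - 1)) 0 * (\<alpha> * \<kappa>)
      * ((\<alpha> * \<kappa> + \<alpha> * \<kappa> / exp (2 * \<eta>)) * (- e_coeff \<eta> k 1 * \<delta> * exp (2 * \<eta>) / \<kappa>)
         - \<alpha> * \<kappa> * (- e_coeff \<eta> k 2 * \<delta> / \<kappa>))"
    by (simp only:)
  also have "(\<alpha> * \<kappa> + \<alpha> * \<kappa> / exp (2 * \<eta>)) * (- e_coeff \<eta> k 1 * \<delta> * exp (2 * \<eta>) / \<kappa>)
         - \<alpha> * \<kappa> * (- e_coeff \<eta> k 2 * \<delta> / \<kappa>)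
      = \<alpha> * \<delta> * (e_coeff \<eta> k 2 - (1 + exp (2 * \<eta>)) * e_coeff \<eta> k 1)"
    using nz by (simp add: field_simps)
  finally have "poly P 0 = b n * poly (?a 1 (n - 1)) 0 * (\<alpha> * \<kappa>)
      * (\<alpha> * \<delta> * (e_coeff \<eta> k 2 - (1 + exp (2 * \<eta>)) * e_coeff \<eta> k 1))" .
  moreover have "poly (?a 1 (n - 1)) 0 \<noteq> 0"
    by (simp add: low_poly_def)
  ultimately have "poly P 0 \<noteq> 0"
    using nz assms e_coeff_step[OF assms(1), of k] by simp
  then have "P \<noteq> 0" by auto
  have "cyclic_det (low_out \<eta> \<xi> k l x) b (up_out \<eta> \<xi> k l x) d n
      = exp x ^ 4 * poly P (exp (- 2 * x))" for x
  proof -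
    define s u where "s = exp x" and "u = exp (- 2 * x)"
    have su: "s\<^sup>2 * u = 1"
      by (simp add: s_def u_def power2_eq_square mult_exp_exp)
    show ?thesis
      unfolding low_poly up_poly s_def[symmetric] u_def[symmetric]
        cyclic_det_scale[OF su, where A = "\<lambda>i j. poly (?a i j) u" and C = "\<lambda>i j. poly (?c i j) u"]
        P_def poly_add poly_diff poly_smult poly_mult
      by (simp add: mult.assoc)
  qed
  then have "{x. cyclic_det (low_out \<eta> \<xi> k l x) b (up_out \<eta> \<xi> k l x) d n = 0}
      = {x. poly P (exp (- 2 * x)) = 0}"
    by simp
  then show ?thesis using countable_exp_poly_zeros[OF \<open>P \<noteq> 0\<close>] by simp
qed

lemma countable_low_zeros:
  "countable {x. low_in \<eta> \<xi> k x i = 0}" "countable {x. low_out \<eta> \<xi> k l x i j = 0}"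
proof -
  have "low_in_poly \<eta> \<xi> k i \<noteq> 0" "low_poly \<eta> \<xi> k l i j \<noteq> 0"
    by (auto simp: low_in_poly_def low_poly_def)
  from this[THEN countable_exp_poly_zeros]
  show "countable {x. low_in \<eta> \<xi> k x i = 0}" "countable {x. low_out \<eta> \<xi> k l x i j = 0}"
    by (simp_all add: low_in_poly low_poly)
qed

lemma countable_not_K_regular: "countable {x. \<not> K_regular \<eta> \<xi> k x}"
proof -
  have "{x. \<not> K_regular \<eta> \<xi> k x} = (\<Union>i. {x. low_in \<eta> \<xi> k x i = 0})" by auto
  then show ?thesis by (simp add: countable_low_zeros)
qed

lemma reflection_generic:
  assumes S: "linear_op S" "intertwines \<eta> k l x y S"
    and T: "linear_op T" "intertwines \<eta> k l x (-y) T"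
    and vac: "S (basis_vec (0, 0)) = basis_vec (0, 0)" "T (basis_vec (0, 0)) = basis_vec (0, 0)"
    and K: "K_regular \<eta> \<xi> k x" "K_regular \<eta> \<xi> l y"
    and a: "\<And>i j. low_out \<eta> \<xi> k l x i j \<noteq> 0"
    and det: "\<And>n. cyclic_det (low_out \<eta> \<xi> k l x) (low_in \<eta> \<xi> l y) (up_out \<eta> \<xi> k l x)
                (up_in \<eta> \<xi> l y) n \<noteq> 0"
  shows "S \<circ> K1_op \<eta> \<xi> k x \<circ> T \<circ> K2_op \<eta> \<xi> l y = K2_op \<eta> \<xi> l y \<circ> T \<circ> K1_op \<eta> \<xi> k x \<circ> S"
    (is "?A = ?B")
proof -
  note coideal = reflection_sides_coideal[OF S T K]
  have linK: "linear_op (K1_op \<eta> \<xi> k x)" "linear_op (K2_op \<eta> \<xi> l y)"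
    by (simp_all add: K1_op_diagonal K2_op_diagonal)
  have lin: "linear_op ?A" "linear_op ?B"
    by (intro linear_op_compose S T linK)+
  define D where "D = (\<lambda>v. ?A v - ?B v)"
  have "linear_op D"
    unfolding D_def by (rule linear_op_diff[OF lin])
  moreover have "D (coideal_low \<eta> \<xi> k l x y v) = coideal_low \<eta> \<xi> k l (-x) (-y) (D v)"
    and "D (coideal_up \<eta> \<xi> k l x y v) = coideal_up \<eta> \<xi> k l (-x) (-y) (D v)" for v
    unfolding D_def coideal
    by (simp_all only: linear_op_minus[OF linear_op_coideal(1)] linear_op_minus[OF linear_op_coideal(3)])
  moreover have "D (basis_vec (0, 0)) = 0"
    by (simp add: D_def K1_op_diagonal K2_op_diagonal vac K_coeff_def)
  moreover have "up_out \<eta> \<xi> k l x 0 j = 0" "up_in \<eta> \<xi> l y 0 = 0" for j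
    by (simp_all add: up_out_def up_in_def)
  ultimately have "D = (\<lambda>v. 0)"
    unfolding coideal_low_def coideal_up_def
    using vacuum_cyclic[OF _ linear_op_ladder(1) linear_op_ladder(2),
        of D "low_out \<eta> \<xi> k l x" "low_in \<eta> \<xi> l y" "low_out \<eta> \<xi> k l (-x)" "\<lambda>i. low_in \<eta> \<xi> l (-y)"
          "up_out \<eta> \<xi> k l x" "up_in \<eta> \<xi> l y" "up_out \<eta> \<xi> k l (-x)" "\<lambda>i. up_in \<eta> \<xi> l (-y)"] a det
    by blast
  then show ?thesis by (auto simp: D_def fun_eq_iff)
qed

section \<open>Weights\<close>

definition weight_preserving :: "(verma2 \<Rightarrow> verma2) \<Rightarrow> bool"
  where "weight_preserving T \<longleftrightarrow> (\<forall>i j i' j'. i' + j' \<noteq> i + j \<longrightarrow> mat_coeff T (i', j') (i, j) = 0)"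

definition level :: "nat \<Rightarrow> (nat \<times> nat) set"
  where "level n = {(i, j). i + j = n}"

lemma finite_level: "finite (level n)"
proof -
  have "level n \<subseteq> {..n} \<times> {..n}" by (auto simp: level_def)
  then show ?thesis by (rule finite_subset) simp
qed

lemma mat_coeff_product:
  assumes "linear_op A" "weight_preserving B"
  shows "mat_coeff (A \<circ> diagonal t \<circ> B) q (i, j)
    = (\<Sum>w\<in>level (i + j). case_prod t w * mat_coeff B w (i, j) * mat_coeff A q w)"
proof -
  have lookup_t: "Poly_Mapping.lookup (diagonal t v) w = case_prod t w * Poly_Mapping.lookup v w" for v w
    by (cases w) (simp add: lookup_diagonal)
  have "Poly_Mapping.keys (diagonal t (B (basis_vec (i, j)))) \<subseteq> level (i + j)"
    using assms(2)[unfolded weight_preserving_def mat_coeff_def, rule_format, of _ _ i j]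
    by (fastforce simp: in_keys_iff lookup_diagonal level_def)
  from linear_op_lookup_expand[OF assms(1) finite_level this] show ?thesis
    by (simp add: mat_coeff_def lookup_t)
qed

lemma mat_coeff_reflection_lhs:
  assumes "linear_op A" "linear_op B" "weight_preserving B"
  shows "mat_coeff (A \<circ> diagonal t \<circ> B \<circ> diagonal s) q (i, j)
    = s i j * (\<Sum>w\<in>level (i + j). case_prod t w * mat_coeff B w (i, j) * mat_coeff A q w)"
proof -
  have lin: "linear_op (A \<circ> diagonal t \<circ> B)"
    by (intro linear_op_compose assms linear_op_ladder)
  have "(A \<circ> diagonal t \<circ> B \<circ> diagonal s) (basis_vec (i, j))
      = scaleC (s i j) ((A \<circ> diagonal t \<circ> B) (basis_vec (i, j)))"
    using linear_op_scale[OF lin, of "s i j" "basis_vec (i, j)"] by simp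
  then show ?thesis
    using mat_coeff_product[OF assms(1,3), of t q i j] by (simp add: mat_coeff_def)
qed

lemma mat_coeff_reflection_rhs:
  assumes "linear_op A" "weight_preserving B"
  shows "mat_coeff (diagonal s \<circ> A \<circ> diagonal t \<circ> B) q (i, j)
    = case_prod s q * (\<Sum>w\<in>level (i + j). case_prod t w * mat_coeff B w (i, j) * mat_coeff A q w)"
  using mat_coeff_product[OF assms, of t q i j]
  by (cases q) (simp add: mat_coeff_def lookup_diagonal)

text \<open>Weight spaces are eigenspaces of \<open>p\<^bsup>h\<^sub>1\<^esup>\<close>, separated from each other as \<open>p\<close> is not a root of unity.\<close>
lemma cartan_weight:
  assumes root: "\<And>n::nat. n > 0 \<Longrightarrow> exp \<eta> ^ n \<noteq> 1"
    and eq: "cartan_coeff \<eta> 1 k i * cartan_coeff \<eta> 1 l j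
      = cartan_coeff \<eta> 1 k i' * cartan_coeff \<eta> 1 l j'"
  shows "i + j = i' + j'"
proof -
  have val: "cartan_coeff \<eta> 1 k i * cartan_coeff \<eta> 1 l j
      = exp (2 * \<eta> * (k + l)) / exp \<eta> ^ (2 * (i + j))" for i j
    by (simp add: cartan_coeff_def mult_exp_exp exp_diff[symmetric] flip: exp_of_nat_mult)
      (simp add: algebra_simps)
  have "exp \<eta> ^ (2 * (i + j)) = exp \<eta> ^ (2 * (i' + j'))"
    using eq unfolding val by simp
  moreover have False if "exp \<eta> ^ (2 * m) = exp \<eta> ^ (2 * m')" "m < m'" for m m'
  proof -
    have "exp \<eta> ^ (2 * m') = exp \<eta> ^ (2 * m) * exp \<eta> ^ (2 * (m' - m))"
      using that(2) by (simp flip: power_add distrib_left)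
    with that(1) have "exp \<eta> ^ (2 * (m' - m)) = 1" by simp
    then show False using root[of "2 * (m' - m)"] that(2) by simp
  qed
  ultimately show ?thesis by (metis linorder_neqE_nat)
qed

lemma intertwines_weight_preserving:
  assumes root: "\<And>n::nat. n > 0 \<Longrightarrow> exp \<eta> ^ n \<noteq> 1"
    and T: "linear_op T" "intertwines \<eta> k l x y T"
  shows "weight_preserving T"
  unfolding weight_preserving_def
proof (intro allI impI)
  fix i j i' j' :: nat
  assume ne: "i' + j' \<noteq> i + j"
  let ?c = "\<lambda>i j. cartan_coeff \<eta> 1 k i * cartan_coeff \<eta> 1 l j"
  have "T (cartan_op \<eta> 1 k l (basis_vec (i, j))) = scaleC (?c i j) (T (basis_vec (i, j)))"
    using linear_op_scale[OF T(1), of "?c i j" "basis_vec (i, j)"] by (simp add: cartan_op_def)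
  then have "scaleC (?c i j) (T (basis_vec (i, j))) = cartan_op \<eta> 1 k l (T (basis_vec (i, j)))"
    by (simp add: intertwines_cartan[OF T(2)])
  from arg_cong[OF this, of "\<lambda>v. Poly_Mapping.lookup v (i', j')"]
  have "?c i j * mat_coeff T (i', j') (i, j) = ?c i' j' * mat_coeff T (i', j') (i, j)"
    by (simp add: mat_coeff_def cartan_op_def lookup_diagonal)
  moreover have "?c i j \<noteq> ?c i' j'"
    using cartan_weight[OF root] ne by metis
  ultimately show "mat_coeff T (i', j') (i, j) = 0" by simp
qed

section \<open>Passage to the limit\<close>

lemma avoid_countable:
  fixes z :: complex
  assumes "countable S"
  shows "\<exists>w. dist w z < inverse (of_nat (Suc n)) \<and> w \<notin> S"
proof -
  have "\<not> ball z (inverse (of_nat (Suc n))) \<subseteq> S"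
    using uncountable_ball[of "inverse (of_nat (Suc n))" z] countable_subset[OF _ assms] by auto
  then show ?thesis by (auto simp: dist_commute)
qed

lemma tendsto_avoiding:
  fixes X :: "nat \<Rightarrow> complex"
  assumes "\<And>n. dist (X n) z < inverse (of_nat (Suc n))"
  shows "X \<longlonglongrightarrow> z"
  unfolding tendsto_dist_iff[of X]
  by (rule tendsto_sandwich[OF _ _ tendsto_const LIMSEQ_inverse_real_of_nat])
    (use assms in \<open>auto intro!: always_eventually less_imp_le\<close>)

lemma regular_at_tendsto:
  assumes "regular_at T z" "Z \<longlonglongrightarrow> z"
  shows "(\<lambda>n. mat_coeff (T (Z n)) q r) \<longlonglongrightarrow> mat_coeff (T z) q r"
  using assms analytic_at_imp_isCont isCont_tendsto_compose unfolding regular_at_def by blast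

lemma K_regular_at_tendsto:
  assumes "regular_at (K_op \<eta> \<xi> k) x" "X \<longlonglongrightarrow> x"
  shows "(\<lambda>n. K_coeff \<eta> \<xi> k (Suc i) (X n)) \<longlonglongrightarrow> K_coeff \<eta> \<xi> k (Suc i) x"
  using regular_at_tendsto[OF assms, of i i] by (simp add: mat_coeff_def K_op_def verma_op_def mvec_def)

text \<open>
  The intertwining relations hold at generic points. At the regular points between them, preservation
  of the weight is what is inherited by continuity and makes the matrix products finite sums.
\<close>
lemma weight_preserving_limit:
  assumes "\<And>n. weight_preserving (T n)"
    and "\<And>q r. (\<lambda>n. mat_coeff (T n) q r) \<longlonglongrightarrow> mat_coeff S q r"
  shows "weight_preserving S"
  unfolding weight_preserving_def
proof (intro allI impI)
  fix i j i' j' :: nat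
  assume "i' + j' \<noteq> i + j"
  then have "(\<lambda>n. mat_coeff (T n) (i', j') (i, j)) = (\<lambda>n. 0)"
    using assms(1) by (auto simp: weight_preserving_def)
  with assms(2)[of "(i', j')" "(i, j)"] show "mat_coeff S (i', j') (i, j) = 0"
    by (simp add: LIMSEQ_const_iff)
qed

text \<open>
  The parameter \<open>y\<close> is chosen first, since the determinants are known not to vanish identically in \<open>x\<close>
  only when \<open>low_in\<close> does not vanish at \<open>y\<close>.
\<close>
lemma countable_generic_x:
  assumes "exp (\<eta>::complex) ^ 4 \<noteq> 1" "countable Z" "K_regular \<eta> \<xi> l y"
  shows "countable {x. \<not> (x - y \<notin> Z \<and> x + y \<notin> Z \<and> K_regular \<eta> \<xi> k x
    \<and> (\<forall>i j. low_out \<eta> \<xi> k l x i j \<noteq> 0)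
    \<and> (\<forall>n. cyclic_det (low_out \<eta> \<xi> k l x) (low_in \<eta> \<xi> l y) (up_out \<eta> \<xi> k l x)
          (up_in \<eta> \<xi> l y) n \<noteq> 0))}" (is "countable ?S")
proof -
  let ?T = "(\<lambda>z. z + y) ` Z \<union> (\<lambda>z. z - y) ` Z \<union> {x. \<not> K_regular \<eta> \<xi> k x}
    \<union> (\<Union>i. \<Union>j. {x. low_out \<eta> \<xi> k l x i j = 0})
    \<union> (\<Union>n. {x. cyclic_det (low_out \<eta> \<xi> k l x) (low_in \<eta> \<xi> l y) (up_out \<eta> \<xi> k l x)
          (up_in \<eta> \<xi> l y) n = 0})"
  have "countable (\<Union>n. {x. cyclic_det (low_out \<eta> \<xi> k l x) (low_in \<eta> \<xi> l y) (up_out \<eta> \<xi> k l x)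
          (up_in \<eta> \<xi> l y) n = 0})"
    by (intro countable_UN countable_cyclic_det_zeros assms(1) assms(3)[rule_format]) simp
  then have "countable ?T"
    using assms(2) countable_low_zeros countable_not_K_regular by (intro countable_Un) auto
  moreover have "?S \<subseteq> ?T"
  proof
    fix x assume "x \<in> ?S"
    moreover have "x - y \<in> Z \<Longrightarrow> x \<in> (\<lambda>z. z + y) ` Z" by (rule image_eqI[of _ _ "x - y"]) simp_all
    moreover have "x + y \<in> Z \<Longrightarrow> x \<in> (\<lambda>z. z - y) ` Z" by (rule image_eqI[of _ _ "x + y"]) simp_all
    ultimately show "x \<in> ?T" by blast
  qed
  ultimately show ?thesis by (rule countable_subset[rotated])
qed

theorem proposition4p9:
  fixes \<eta> \<xi> :: complex
    and R :: "complex \<Rightarrow> complex \<Rightarrow> complex \<Rightarrow> verma2 \<Rightarrow> verma2"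
  assumes not_root_of_unity: "\<And>n::nat. n > 0 \<Longrightarrow> exp \<eta> ^ n \<noteq> 1"
    and R: "is_R_operator \<eta> R"
  shows "\<forall>k l x y.
    regular_at (R k l) (x - y) \<longrightarrow> regular_at (R k l) (x + y) \<longrightarrow>
    regular_at (K_op \<eta> \<xi> k) x \<longrightarrow> regular_at (K_op \<eta> \<xi> l) y \<longrightarrow>
      R k l (x - y) \<circ> K1_op \<eta> \<xi> k x \<circ> R k l (x + y) \<circ> K2_op \<eta> \<xi> l y
      = K2_op \<eta> \<xi> l y \<circ> R k l (x + y) \<circ> K1_op \<eta> \<xi> k x \<circ> R k l (x - y)"
proof (intro allI impI)
  fix k l x y
  assume reg: "regular_at (R k l) (x - y)" "regular_at (R k l) (x + y)"
    and regK: "regular_at (K_op \<eta> \<xi> k) x" "regular_at (K_op \<eta> \<xi> l) y"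
  have lin: "linear_op (R k l z)" for z
    using R by (simp add: is_R_operator_def)
  have "mvec 1 \<otimes>\<^sub>v mvec 1 = basis_vec (0, 0)"
    by (simp add: mvec_def del: single_one)
  then have vac: "R k l z (basis_vec (0, 0)) = basis_vec (0, 0)" for z
    using R unfolding is_R_operator_def by metis
  obtain Z where Z: "countable Z" "\<And>x y. x - y \<notin> Z \<Longrightarrow> intertwines \<eta> k l x y (R k l (x - y))"
    using R unfolding is_R_operator_def by metis
  have p4: "exp \<eta> ^ 4 \<noteq> 1"
    using not_root_of_unity[of 4] by simp

  have "\<exists>v. dist v y < inverse (of_nat (Suc n)) \<and> K_regular \<eta> \<xi> l v" for n
    using avoid_countable[OF countable_not_K_regular[of \<eta> \<xi> l], of y n] by auto
  then obtain Y where Y: "\<And>n. dist (Y n) y < inverse (of_nat (Suc n))"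
    and Y_reg: "\<And>n. K_regular \<eta> \<xi> l (Y n)"
    by metis
  have "\<exists>u. dist u x < inverse (of_nat (Suc n)) \<and> u - Y n \<notin> Z \<and> u + Y n \<notin> Z \<and> K_regular \<eta> \<xi> k u
      \<and> (\<forall>i j. low_out \<eta> \<xi> k l u i j \<noteq> 0)
      \<and> (\<forall>m. cyclic_det (low_out \<eta> \<xi> k l u) (low_in \<eta> \<xi> l (Y n)) (up_out \<eta> \<xi> k l u)
            (up_in \<eta> \<xi> l (Y n)) m \<noteq> 0)" for n
    using avoid_countable[OF countable_generic_x[OF p4 Z(1) Y_reg[of n]], of x n k]
    unfolding mem_Collect_eq not_not .
  then obtain X where X: "\<And>n. dist (X n) x < inverse (of_nat (Suc n))"
    and X_Z: "\<And>n. X n - Y n \<notin> Z" "\<And>n. X n + Y n \<notin> Z"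
    and X_reg: "\<And>n. K_regular \<eta> \<xi> k (X n)"
    and low: "\<And>n i j. low_out \<eta> \<xi> k l (X n) i j \<noteq> 0"
    and det: "\<And>n m. cyclic_det (low_out \<eta> \<xi> k l (X n)) (low_in \<eta> \<xi> l (Y n)) (up_out \<eta> \<xi> k l (X n))
            (up_in \<eta> \<xi> l (Y n)) m \<noteq> 0"
    by metis
  define S T where "S n = R k l (X n - Y n)" and "T n = R k l (X n + Y n)" for n
  have intertw: "intertwines \<eta> k l (X n) (Y n) (S n)" "intertwines \<eta> k l (X n) (- Y n) (T n)" for n
    using Z(2)[of "X n" "Y n"] Z(2)[of "X n" "- Y n"] X_Z[of n] by (simp_all add: S_def T_def)
  have linST: "linear_op (S n)" "linear_op (T n)" for n
    by (simp_all add: S_def T_def lin)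
  have generic: "S n \<circ> K1_op \<eta> \<xi> k (X n) \<circ> T n \<circ> K2_op \<eta> \<xi> l (Y n)
      = K2_op \<eta> \<xi> l (Y n) \<circ> T n \<circ> K1_op \<eta> \<xi> k (X n) \<circ> S n" for n
    by (rule reflection_generic[OF linST(1) intertw(1) linST(2) intertw(2)])
      (use X_reg Y_reg low det in \<open>auto simp: S_def T_def vac\<close>)

  have XY: "X \<longlonglongrightarrow> x" "Y \<longlonglongrightarrow> y"
    by (rule tendsto_avoiding, rule X) (rule tendsto_avoiding, rule Y)
  have limR: "(\<lambda>n. mat_coeff (S n) q r) \<longlonglongrightarrow> mat_coeff (R k l (x - y)) q r"
      "(\<lambda>n. mat_coeff (T n) q r) \<longlonglongrightarrow> mat_coeff (R k l (x + y)) q r" for q r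
    unfolding S_def T_def
    by (rule regular_at_tendsto[OF reg(1) tendsto_diff[OF XY]],
        rule regular_at_tendsto[OF reg(2) tendsto_add[OF XY]])
  note limK = K_regular_at_tendsto[OF regK(1) XY(1)] K_regular_at_tendsto[OF regK(2) XY(2)]
  have wST: "weight_preserving (S n)" "weight_preserving (T n)" for n
    using intertwines_weight_preserving[OF not_root_of_unity linST(1) intertw(1)]
      intertwines_weight_preserving[OF not_root_of_unity linST(2) intertw(2)] by blast+
  have wR: "weight_preserving (R k l (x - y))" "weight_preserving (R k l (x + y))"
    by (rule weight_preserving_limit[OF wST(1) limR(1)], rule weight_preserving_limit[OF wST(2) limR(2)])

  let ?A = "R k l (x - y) \<circ> K1_op \<eta> \<xi> k x \<circ> R k l (x + y) \<circ> K2_op \<eta> \<xi> l y"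
    and ?B = "K2_op \<eta> \<xi> l y \<circ> R k l (x + y) \<circ> K1_op \<eta> \<xi> k x \<circ> R k l (x - y)"
  have entries: "mat_coeff ?A (i', j') (i, j) = mat_coeff ?B (i', j') (i, j)" for i j i' j'
  proof (rule LIMSEQ_unique)
    show "(\<lambda>n. mat_coeff (S n \<circ> K1_op \<eta> \<xi> k (X n) \<circ> T n \<circ> K2_op \<eta> \<xi> l (Y n)) (i', j') (i, j))
        \<longlonglongrightarrow> mat_coeff ?A (i', j') (i, j)"
      unfolding K1_op_diagonal K2_op_diagonal mat_coeff_reflection_lhs[OF linST wST(2)]
        mat_coeff_reflection_lhs[OF lin lin wR(2)] case_prod_beta
      by (intro tendsto_mult tendsto_sum limK limR)
    show "(\<lambda>n. mat_coeff (S n \<circ> K1_op \<eta> \<xi> k (X n) \<circ> T n \<circ> K2_op \<eta> \<xi> l (Y n)) (i', j') (i, j))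
        \<longlonglongrightarrow> mat_coeff ?B (i', j') (i, j)"
      unfolding generic
      unfolding K1_op_diagonal K2_op_diagonal mat_coeff_reflection_rhs[OF linST(2) wST(1)]
        mat_coeff_reflection_rhs[OF lin wR(1)] case_prod_beta
      by (intro tendsto_mult tendsto_sum limK limR)
  qed
  have "linear_op ?A" "linear_op ?B"
    unfolding K1_op_diagonal K2_op_diagonal by (intro linear_op_compose lin linear_op_ladder)+
  then show "?A = ?B"
  proof (rule linear_op_eqI)
    fix q :: "nat \<times> nat"
    show "?A (basis_vec q) = ?B (basis_vec q)"
    proof (rule poly_mapping_eqI)
      fix r
      show "Poly_Mapping.lookup (?A (basis_vec q)) r = Poly_Mapping.lookup (?B (basis_vec q)) r"
        using entries[of "fst r" "snd r" "fst q" "snd q"] unfolding mat_coeff_def by simp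
    qed
  qed
qed

end
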